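(* Let $(M,\langle\cdot,\cdot\rangle)$ be a Riemannian manifold. The class of $g$-natural paracontact metric structures $\{(\widetilde\varphi,\widetilde\xi,\widetilde\eta,\widetilde G)\}$ on $T_1M$ is invariant under $\mathcal D$-homothetic deformations: if $(\widetilde\varphi,\widetilde\xi,\widetilde\eta,\widetilde G)$ is a $g$-natural paracontact metric structure on $T_1M$ and $t\neq0$ is a real constant, then its $\mathcal D_t$-homothetic deformation $(\widetilde\varphi_t,\widetilde\xi_t,\widetilde\eta_t,\widetilde G_t)$ is again a $g$-natural paracontact metric structure on $T_1M$.
   Context: $(M,\langle\cdot,\cdot\rangle)$ is a Riemannian manifold of dimension $n+1$ with $n\ge1$, with Levi-Civita connection $\nabla$; $M_x$ is its tangent space at $x$. $T_1M=\{(x,u)\in TM:\langle u,u\rangle=1\}$, of dimension $2n+1$. For $X\in M_x$, $X^h$ and $X^v$ denote the horizontal (with respect to $\nabla$) and vertical lifts to $(x,u)$; $u^h$ is the geodesic flow vector field. The tangent space of $T_1M$ at $(x,u)$ is $\{X^h+Y^v: X,Y\in M_x,\ Y\perp u\}$. A $g$-natural metric $\widetilde G$ on $T_1M$ is determined by four real constants $a,b,c,d$ through $$\widetilde G_{(x,u)}(X_1^h,X_2^h)=(a+c)\langle X_1,X_2\rangle+d\langle X_1,u\rangle\langle X_2,u\rangle,\quad \widetilde G_{(x,u)}(X_1^h,Y_1^v)=b\langle X_1,Y_1\rangle,\quad \widetilde G_{(x,u)}(Y_1^v,Y_2^v)=a\langle Y_1,Y_2\rangle,$$ for $X_i,Y_i\in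 M_x$ with $Y_i\perp u$. Put $\alpha=a(a+c)-b^2$, $\phi=a(a+c+d)-b^2$. The tangential lift is $X^{t_G}=X^v-\langle X,u\rangle u^v+\frac{b}{a+c+d}\langle X,u\rangle u^h$ (so $Y^{t_G}=Y^v$ if $Y\perp u$). An almost paracontact structure $(\varphi,\xi,\eta)$ on a $(2n+1)$-manifold consists of a $(1,1)$-tensor field $\varphi$, a vector field $\xi$ and a $1$-form $\eta$ such that $\eta(\xi)=1$, $\varphi^2=I-\eta\otimes\xi$, and the eigendistributions of $\varphi$ for the eigenvalues $1$ and $-1$ both have dimension $n$. $(\varphi,\xi,\eta,g)$ is a paracontact metric structure if moreover the pseudo-Riemannian metric $g$ satisfies $g(\varphi X,\varphi Y)=-g(X,Y)+\eta(X)\eta(Y)$ and $d\eta(X,Y)=g(X,\varphi Y)$, with $2\,d\eta(X,Y)=X\eta(Y)-Y\eta(X)-\eta([X,Y])$. A $g$-natural paracontact metric structure on $T_1M$ is a paracontact metric structure $(\widetilde\varphi,\widetilde\xi,\widetilde\eta,\widetilde G)$ where $\widetilde G$ is a pseudo-Riemannian $g$-natural metric with constants $a,b,c,d$ and, for some real constant $\rho>0$, $$\widetilde\xi=\rho u^h,\quad \widetilde\eta(X^h)=\tfrac1\rho\langle X,u\rangle,\quad \widetilde\eta(Y^{t_G})=b\rho\langle Y,u\rangle,$$ $$\widetilde\varphi(X^h)=\tfrac{1}{2\rho\alpha}\big(-bX^h+(a+c)X^{t_G}+\tfrac{bd}{a+c+d}\langle X,u\rangle u^h\big),\quad \widetilde\varphi(Y^{t_G})=\tfrac{1}{2\rho\alpha}\big(-aY^h+bY^{t_G}+\tfrac{\phi}{a+c+d}\langle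 Y,u\rangle u^h\big)$$ for all $X,Y\in M_x$; here the constants satisfy $a+c+d=-4\alpha=\frac1{\rho^2}$, which is the condition for $\widetilde G$ to be an associated metric. The $\mathcal D_t$-homothetic deformation ($t\ne0$ a real constant) of a paracontact metric structure $(\varphi,\xi,\eta,g)$ is the paracontact metric structure $(\varphi_t,\xi_t,\eta_t,g_t)$ with $g_t=tg+t(t-1)\eta\otimes\eta$, $\eta_t=t\eta$, $\varphi_t=\varphi$, $\xi_t=\frac1t\xi$.
   Formalization: For t<0 the deformation has ξ_t=(ρ/t)u^h, so the class with ρ>0 is not invariant; it is proved that the class with ρ>0 is invariant for t>0, and that the class with ρ≠0 (same equations, sign condition dropped) is invariant for every t≠0. *)

theory Defs
  imports "HOL-Analysis.Analysis" "HOL-Library.Function_Algebras"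
begin

section \<open>Smooth maps between Euclidean spaces\<close>

primrec Ck_on :: "nat \<Rightarrow> 'a::euclidean_space set \<Rightarrow> ('a \<Rightarrow> 'b::real_normed_vector) \<Rightarrow> bool" where
  "Ck_on 0 S f \<longleftrightarrow> continuous_on S f"
| "Ck_on (Suc k) S f \<longleftrightarrow> (\<forall>x\<in>S. f differentiable (at x)) \<and>
     (\<forall>v. Ck_on k S (\<lambda>x. frechet_derivative f (at x) v))"

text \<open>Meaningful for open \<open>S\<close> only.\<close>

definition smooth_on :: "'a::euclidean_space set \<Rightarrow> ('a \<Rightarrow> 'b::real_normed_vector) \<Rightarrow> bool" where
  "smooth_on S f \<longleftrightarrow> (\<forall>k. Ck_on k S f)"


section \<open>Spaces with smooth functions, tangent vectors, tensor fields\<close>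

text \<open>
  \<open>smooth_at X p f\<close> means that \<open>f\<close> is smooth on some neighbourhood of \<open>p\<close> in \<open>pts X\<close>; away from
  \<open>p\<close> (and outside \<open>pts X\<close>) the values of \<open>f\<close> are arbitrary.  Thus these functions
  represent the germs of smooth functions at \<open>p\<close>, and no separate treatment of locally
  defined functions and vector fields is needed.
\<close>

record 'p smooth_space =
  pts :: "'p set"
  smooth_at :: "'p \<Rightarrow> ('p \<Rightarrow> real) \<Rightarrow> bool"

type_synonym 'p tvec = "('p \<Rightarrow> real) \<Rightarrow> real"
type_synonym 'p field = "'p \<Rightarrow> 'p tvec"
type_synonym 'p form = "'p \<Rightarrow> 'p tvec \<Rightarrow> real"
type_synonym 'p endo = "'p \<Rightarrow> 'p tvec \<Rightarrow> 'p tvec"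
type_synonym 'p bilin = "'p \<Rightarrow> 'p tvec \<Rightarrow> 'p tvec \<Rightarrow> real"

definition tscale :: "real \<Rightarrow> ('a \<Rightarrow> real) \<Rightarrow> 'a \<Rightarrow> real"  (infixr "*\<^sub>T" 75) where
  "c *\<^sub>T D = (\<lambda>f. c * D f)"

lemma vector_space_tscale: "vector_space tscale"
  by unfold_locales (auto simp: tscale_def fun_eq_iff algebra_simps)

text \<open>
  The tangent space is the space of derivations of the algebra of germs at \<open>p\<close>.  Requiring
  value 0 on functions that are not smooth at \<open>p\<close> makes equality of tangent vectors equality
  of HOL functions.
\<close>

definition tangent_space :: "('p, 'z) smooth_space_scheme \<Rightarrow> 'p \<Rightarrow> 'p tvec set" where
  "tangent_space X p = {D.
     (\<forall>f g. smooth_at X p f \<longrightarrow> smooth_at X p g \<longrightarrow>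
        D (\<lambda>q. f q + g q) = D f + D g \<and>
        D (\<lambda>q. f q * g q) = f p * D g + g p * D f) \<and>
     (\<forall>c f. smooth_at X p f \<longrightarrow> D (\<lambda>q. c * f q) = c * D f) \<and>
     (\<forall>f. \<not> smooth_at X p f \<longrightarrow> D f = 0)}"

text \<open>
  \<open>V\<close> is a (not necessarily continuous) section of the tangent bundle that is smooth near \<open>p\<close>.
\<close>

definition field_smooth_at :: "('p, 'z) smooth_space_scheme \<Rightarrow> 'p \<Rightarrow> 'p field \<Rightarrow> bool" where
  "field_smooth_at X p V \<longleftrightarrow> (\<forall>q\<in>pts X. V q \<in> tangent_space X q) \<and>
     (\<forall>f. smooth_at X p f \<longrightarrow> smooth_at X p (\<lambda>q. V q f))"

definition vector_field :: "('p, 'z) smooth_space_scheme \<Rightarrow> 'p field \<Rightarrow> bool" where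
  "vector_field X V \<longleftrightarrow> (\<forall>p\<in>pts X. field_smooth_at X p V)"

definition one_form :: "('p, 'z) smooth_space_scheme \<Rightarrow> 'p form \<Rightarrow> bool" where
  "one_form X \<eta> \<longleftrightarrow> (\<forall>p\<in>pts X.
     (\<forall>D\<in>tangent_space X p. \<forall>E\<in>tangent_space X p. \<eta> p (D + E) = \<eta> p D + \<eta> p E) \<and>
     (\<forall>c. \<forall>D\<in>tangent_space X p. \<eta> p (c *\<^sub>T D) = c * \<eta> p D) \<and>
     (\<forall>V. field_smooth_at X p V \<longrightarrow> smooth_at X p (\<lambda>q. \<eta> q (V q))))"

definition endo_field :: "('p, 'z) smooth_space_scheme \<Rightarrow> 'p endo \<Rightarrow> bool" where
  "endo_field X \<phi> \<longleftrightarrow> (\<forall>p\<in>pts X.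
     (\<forall>D\<in>tangent_space X p. \<phi> p D \<in> tangent_space X p) \<and>
     (\<forall>D\<in>tangent_space X p. \<forall>E\<in>tangent_space X p. \<phi> p (D + E) = \<phi> p D + \<phi> p E) \<and>
     (\<forall>c. \<forall>D\<in>tangent_space X p. \<phi> p (c *\<^sub>T D) = c *\<^sub>T \<phi> p D) \<and>
     (\<forall>V. field_smooth_at X p V \<longrightarrow> field_smooth_at X p (\<lambda>q. \<phi> q (V q))))"

definition symmetric_tensor :: "('p, 'z) smooth_space_scheme \<Rightarrow> 'p bilin \<Rightarrow> bool" where
  "symmetric_tensor X g \<longleftrightarrow> (\<forall>p\<in>pts X.
     (\<forall>D\<in>tangent_space X p. \<forall>E\<in>tangent_space X p. g p D E = g p E D) \<and>
     (\<forall>D\<in>tangent_space X p. \<forall>E\<in>tangent_space X p. \<forall>F\<in>tangent_space X p.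
        g p (D + E) F = g p D F + g p E F) \<and>
     (\<forall>c. \<forall>D\<in>tangent_space X p. \<forall>E\<in>tangent_space X p. g p (c *\<^sub>T D) E = c * g p D E) \<and>
     (\<forall>V W. field_smooth_at X p V \<longrightarrow> field_smooth_at X p W \<longrightarrow>
        smooth_at X p (\<lambda>q. g q (V q) (W q))))"

definition pseudo_riemannian_metric :: "('p, 'z) smooth_space_scheme \<Rightarrow> 'p bilin \<Rightarrow> bool" where
  "pseudo_riemannian_metric X g \<longleftrightarrow> symmetric_tensor X g \<and>
     (\<forall>p\<in>pts X. \<forall>D\<in>tangent_space X p. (\<forall>E\<in>tangent_space X p. g p D E = 0) \<longrightarrow> D = 0)"

definition riemannian_metric :: "('p, 'z) smooth_space_scheme \<Rightarrow> 'p bilin \<Rightarrow> bool" where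
  "riemannian_metric X g \<longleftrightarrow> symmetric_tensor X g \<and>
     (\<forall>p\<in>pts X. \<forall>D\<in>tangent_space X p. D \<noteq> 0 \<longrightarrow> g p D D > 0)"

definition lie_bracket :: "('p, 'z) smooth_space_scheme \<Rightarrow> 'p field \<Rightarrow> 'p field \<Rightarrow> 'p field" where
  "lie_bracket X V W p =
     (\<lambda>f. if smooth_at X p f then V p (\<lambda>q. W q f) - W p (\<lambda>q. V q f) else 0)"

definition ext_deriv :: "('p, 'z) smooth_space_scheme \<Rightarrow> 'p form \<Rightarrow> 'p field \<Rightarrow> 'p field \<Rightarrow> 'p \<Rightarrow> real"
  where
  "ext_deriv X \<eta> V W p =
     (V p (\<lambda>q. \<eta> q (W q)) - W p (\<lambda>q. \<eta> q (V q)) - \<eta> p (lie_bracket X V W p)) / 2"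

text \<open>
  Connections act on germs of vector fields: all laws are required at every point near which the
  fields in question are smooth.  An operator on global fields is local, so it determines such an
  operator (put \<open>nabla V W p = 0\<close> if \<open>V\<close> or \<open>W\<close> is not smooth near \<open>p\<close>).
\<close>

definition affine_connection ::
    "('p, 'z) smooth_space_scheme \<Rightarrow> ('p field \<Rightarrow> 'p field \<Rightarrow> 'p field) \<Rightarrow> bool" where
  "affine_connection X nabla \<longleftrightarrow> (\<forall>p\<in>pts X. \<forall>U V W.
     field_smooth_at X p U \<longrightarrow> field_smooth_at X p V \<longrightarrow> field_smooth_at X p W \<longrightarrow>
       field_smooth_at X p (nabla V W) \<and>
       nabla (\<lambda>q. U q + V q) W p = nabla U W p + nabla V W p \<and>
       nabla U (\<lambda>q. V q + W q) p = nabla U V p + nabla U W p \<and>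
       (\<forall>f. smooth_at X p f \<longrightarrow>
          nabla (\<lambda>q. f q *\<^sub>T V q) W p = f p *\<^sub>T nabla V W p \<and>
          nabla V (\<lambda>q. f q *\<^sub>T W q) p = V p f *\<^sub>T W p + f p *\<^sub>T nabla V W p))"

definition levi_civita_connection ::
    "('p, 'z) smooth_space_scheme \<Rightarrow> 'p bilin \<Rightarrow> ('p field \<Rightarrow> 'p field \<Rightarrow> 'p field) \<Rightarrow> bool" where
  "levi_civita_connection X g nabla \<longleftrightarrow> affine_connection X nabla \<and>
     (\<forall>p\<in>pts X. \<forall>U V W.
        field_smooth_at X p U \<longrightarrow> field_smooth_at X p V \<longrightarrow> field_smooth_at X p W \<longrightarrow>
          nabla V W p - nabla W V p = lie_bracket X V W p \<and>
          U p (\<lambda>q. g q (V q) (W q)) = g p (nabla U V p) (W p) + g p (V p) (nabla U W p))"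


section \<open>Paracontact metric structures\<close>

type_synonym 'p pc_structure = "'p endo \<times> 'p field \<times> 'p form \<times> 'p bilin"

definition almost_paracontact_structure ::
    "('p, 'z) smooth_space_scheme \<Rightarrow> nat \<Rightarrow> 'p endo \<Rightarrow> 'p field \<Rightarrow> 'p form \<Rightarrow> bool" where
  "almost_paracontact_structure X n \<phi> \<xi> \<eta> \<longleftrightarrow>
     endo_field X \<phi> \<and> vector_field X \<xi> \<and> one_form X \<eta> \<and>
     (\<forall>p\<in>pts X. \<eta> p (\<xi> p) = 1 \<and>
        (\<forall>D\<in>tangent_space X p. \<phi> p (\<phi> p D) = D - \<eta> p D *\<^sub>T \<xi> p) \<and>
        vector_space.dim tscale {D \<in> tangent_space X p. \<phi> p D = D} = n \<and>
        vector_space.dim tscale {D \<in> tangent_space X p. \<phi> p D = - D} = n)"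

definition paracontact_metric_structure ::
    "('p, 'z) smooth_space_scheme \<Rightarrow> nat \<Rightarrow> 'p pc_structure \<Rightarrow> bool" where
  "paracontact_metric_structure X n = (\<lambda>(\<phi>, \<xi>, \<eta>, g).
     almost_paracontact_structure X n \<phi> \<xi> \<eta> \<and>
     pseudo_riemannian_metric X g \<and>
     (\<forall>p\<in>pts X. \<forall>D\<in>tangent_space X p. \<forall>E\<in>tangent_space X p.
        g p (\<phi> p D) (\<phi> p E) = - g p D E + \<eta> p D * \<eta> p E) \<and>
     (\<forall>p\<in>pts X. \<forall>V W. field_smooth_at X p V \<longrightarrow> field_smooth_at X p W \<longrightarrow>
        ext_deriv X \<eta> V W p = g p (V p) (\<phi> p (W p))))"

definition D_homothetic :: "real \<Rightarrow> 'p pc_structure \<Rightarrow> 'p pc_structure" where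
  "D_homothetic t = (\<lambda>(\<phi>, \<xi>, \<eta>, g).
     (\<phi>,
      \<lambda>p. (1 / t) *\<^sub>T \<xi> p,
      \<lambda>p D. t * \<eta> p D,
      \<lambda>p D E. t * g p D E + t * (t - 1) * (\<eta> p D * \<eta> p E)))"


section \<open>Manifolds, tangent bundle, unit tangent bundle\<close>

type_synonym ('p, 'e) chart = "'p set \<times> ('p \<Rightarrow> 'e)"

definition manifold_space :: "('p, 'e::euclidean_space) chart set \<Rightarrow> 'p smooth_space" where
  "manifold_space A = \<lparr> pts = \<Union> (fst ` A),
     smooth_at = (\<lambda>p f. \<forall>(U, \<kappa>)\<in>A. p \<in> U \<longrightarrow>
       (\<exists>W. open W \<and> \<kappa> p \<in> W \<and> W \<subseteq> \<kappa> ` U \<and> smooth_on W (f \<circ> inv_into U \<kappa>))) \<rparr>"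

text \<open>
  A smooth manifold of dimension \<open>CARD('n)\<close> whose underlying (Hausdorff, second countable) space
  is the whole type \<open>'m\<close>.
\<close>

definition smooth_manifold ::
    "('m::{t2_space,second_countable_topology}, real ^ 'n::finite) chart set \<Rightarrow> bool" where
  "smooth_manifold A \<longleftrightarrow>
     \<Union> (fst ` A) = UNIV \<and>
     (\<forall>(U, \<kappa>)\<in>A. open U \<and> open (\<kappa> ` U) \<and> (\<exists>\<iota>. homeomorphism U (\<kappa> ` U) \<kappa> \<iota>)) \<and>
     (\<forall>(U, \<kappa>)\<in>A. \<forall>(V, \<mu>)\<in>A. smooth_on (\<kappa> ` (U \<inter> V)) (\<mu> \<circ> inv_into U \<kappa>))"

text \<open>The derivative at \<open>p\<close> in the direction with coordinates \<open>w\<close> in the given chart.\<close>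

definition chart_vec ::
    "('p, 'z) smooth_space_scheme \<Rightarrow> ('p, 'e::euclidean_space) chart \<Rightarrow> 'p \<Rightarrow> 'e \<Rightarrow> 'p tvec" where
  "chart_vec X = (\<lambda>(U, \<kappa>) p w f.
     if smooth_at X p f then frechet_derivative (f \<circ> inv_into U \<kappa>) (at (\<kappa> p)) w else 0)"

definition components :: "('m, real ^ 'n::finite) chart \<Rightarrow> 'm tvec \<Rightarrow> real ^ 'n" where
  "components = (\<lambda>(U, \<kappa>) D. \<chi> k. D (\<lambda>y. \<kappa> y $ k))"

definition tangent_chart ::
    "('m, real ^ 'n::finite) chart set \<Rightarrow> ('m, real ^ 'n) chart
       \<Rightarrow> ('m \<times> 'm tvec, (real ^ 'n) \<times> (real ^ 'n)) chart" where
  "tangent_chart A = (\<lambda>(U, \<kappa>).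
     ({(x, u). x \<in> U \<and> u \<in> tangent_space (manifold_space A) x},
      \<lambda>(x, u). (\<kappa> x, components (U, \<kappa>) u)))"

definition tangent_bundle :: "('m, real ^ 'n::finite) chart set \<Rightarrow> ('m \<times> 'm tvec) smooth_space" where
  "tangent_bundle A = manifold_space (tangent_chart A ` A)"

text \<open>
  An embedded submanifold carries the functions that locally extend to smooth functions on the
  ambient manifold.  Agreement on all of \<open>S\<close> costs nothing, because \<open>smooth_at X p F\<close> says nothing
  about \<open>F\<close> away from \<open>p\<close>.
\<close>

definition submanifold_space :: "('p, 'z) smooth_space_scheme \<Rightarrow> 'p set \<Rightarrow> 'p smooth_space" where
  "submanifold_space X S = \<lparr> pts = S,
     smooth_at = (\<lambda>p f. \<exists>F. smooth_at X p F \<and> (\<forall>q\<in>S. f q = F q)) \<rparr>"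

definition unit_tangent_bundle ::
    "('m, real ^ 'n::finite) chart set \<Rightarrow> 'm bilin \<Rightarrow> ('m \<times> 'm tvec) smooth_space" where
  "unit_tangent_bundle A g = submanifold_space (tangent_bundle A)
     {(x, u). x \<in> pts (manifold_space A) \<and> u \<in> tangent_space (manifold_space A) x \<and> g x u u = 1}"


section \<open>Lifts\<close>

definition coordinate_field ::
    "('m, real ^ 'n::finite) chart set \<Rightarrow> ('m, real ^ 'n) chart \<Rightarrow> 'n \<Rightarrow> 'm field" where
  "coordinate_field A c i y =
     (if y \<in> fst c then chart_vec (manifold_space A) c y (axis i 1) else 0)"

definition christoffel ::
    "('m, real ^ 'n::finite) chart set \<Rightarrow> ('m field \<Rightarrow> 'm field \<Rightarrow> 'm field) \<Rightarrow> ('m, real ^ 'n) chart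
       \<Rightarrow> 'm \<Rightarrow> 'n \<Rightarrow> 'n \<Rightarrow> 'n \<Rightarrow> real" where
  "christoffel A nabla c x k i j =
     components c (nabla (coordinate_field A c i) (coordinate_field A c j) x) $ k"

text \<open>
  In coordinates, \<open>X\<^sup>h\<close> at \<open>(x, u)\<close> is
  \<open>\<Sum>\<^sub>i X\<^sub>i \<partial>/\<partial>x\<^sub>i - \<Sum>\<^sub>k (\<Sum>\<^sub>i \<Sum>\<^sub>j \<Gamma>\<^sub>k\<^sub>i\<^sub>j X\<^sub>i u\<^sub>j) \<partial>/\<partial>u\<^sub>k\<close>;
  the result does not depend on the chart.
\<close>

definition horizontal_lift ::
    "('m, real ^ 'n::finite) chart set \<Rightarrow> ('m field \<Rightarrow> 'm field \<Rightarrow> 'm field)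
       \<Rightarrow> 'm \<times> 'm tvec \<Rightarrow> 'm tvec \<Rightarrow> ('m \<times> 'm tvec) tvec" where
  "horizontal_lift A nabla = (\<lambda>(x, u) X.
     let c = (SOME c. c \<in> A \<and> x \<in> fst c) in
     chart_vec (tangent_bundle A) (tangent_chart A c) (x, u)
       (components c X,
        - (\<chi> k. \<Sum>i\<in>UNIV. \<Sum>j\<in>UNIV.
             christoffel A nabla c x k i j * components c X $ i * components c u $ j)))"

definition vertical_lift ::
    "('m, real ^ 'n::finite) chart set \<Rightarrow> 'm \<times> 'm tvec \<Rightarrow> 'm tvec \<Rightarrow> ('m \<times> 'm tvec) tvec" where
  "vertical_lift A = (\<lambda>(x, u) Y F.
     if smooth_at (tangent_bundle A) (x, u) F then deriv (\<lambda>s. F (x, u + s *\<^sub>T Y)) 0 else 0)"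

text \<open>
  \<open>unit_normalize g\<close> retracts the nonzero tangent vectors onto the unit tangent bundle.  Hence, for
  a tangent vector \<open>D\<close> of the tangent bundle that is tangent to the unit tangent bundle,
  \<open>restrict_tvec A g p D\<close> is \<open>D\<close> viewed as a tangent vector of the unit tangent bundle: the function
  \<open>f \<circ> unit_normalize g\<close> is a smooth extension of \<open>f\<close>.
\<close>

definition unit_normalize :: "'m bilin \<Rightarrow> 'm \<times> 'm tvec \<Rightarrow> 'm \<times> 'm tvec" where
  "unit_normalize g = (\<lambda>(x, u). (x, (1 / sqrt (g x u u)) *\<^sub>T u))"

definition restrict_tvec ::
    "('m, real ^ 'n::finite) chart set \<Rightarrow> 'm bilin \<Rightarrow> 'm \<times> 'm tvec
       \<Rightarrow> ('m \<times> 'm tvec) tvec \<Rightarrow> ('m \<times> 'm tvec) tvec" where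
  "restrict_tvec A g p D =
     (\<lambda>f. if smooth_at (unit_tangent_bundle A g) p f then D (f \<circ> unit_normalize g) else 0)"

definition unit_horizontal_lift ::
    "('m, real ^ 'n::finite) chart set \<Rightarrow> 'm bilin \<Rightarrow> ('m field \<Rightarrow> 'm field \<Rightarrow> 'm field)
       \<Rightarrow> 'm \<times> 'm tvec \<Rightarrow> 'm tvec \<Rightarrow> ('m \<times> 'm tvec) tvec" where
  "unit_horizontal_lift A g nabla p X = restrict_tvec A g p (horizontal_lift A nabla p X)"

text \<open>Only used for \<open>Y\<close> orthogonal to \<open>u\<close>, where \<open>p = (x, u)\<close>.\<close>

definition unit_vertical_lift ::
    "('m, real ^ 'n::finite) chart set \<Rightarrow> 'm bilin
       \<Rightarrow> 'm \<times> 'm tvec \<Rightarrow> 'm tvec \<Rightarrow> ('m \<times> 'm tvec) tvec" where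
  "unit_vertical_lift A g p Y = restrict_tvec A g p (vertical_lift A p Y)"

text \<open>\<open>a\<close>, \<open>b\<close>, \<open>c\<close>, \<open>d\<close> are the constants of the \<open>g\<close>-natural metric.\<close>

definition tangential_lift ::
    "('m, real ^ 'n::finite) chart set \<Rightarrow> 'm bilin \<Rightarrow> ('m field \<Rightarrow> 'm field \<Rightarrow> 'm field)
       \<Rightarrow> real \<Rightarrow> real \<Rightarrow> real \<Rightarrow> real \<Rightarrow> 'm \<times> 'm tvec \<Rightarrow> 'm tvec \<Rightarrow> ('m \<times> 'm tvec) tvec" where
  "tangential_lift A g nabla a b c d = (\<lambda>(x, u) X.
     restrict_tvec A g (x, u)
       (vertical_lift A (x, u) X - g x X u *\<^sub>T vertical_lift A (x, u) u
        + (b / (a + c + d) * g x X u) *\<^sub>T horizontal_lift A nabla (x, u) u))"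


section \<open>\<open>g\<close>-natural structures on the unit tangent bundle\<close>

definition g_natural_metric ::
    "('m, real ^ 'n::finite) chart set \<Rightarrow> 'm bilin \<Rightarrow> ('m field \<Rightarrow> 'm field \<Rightarrow> 'm field)
       \<Rightarrow> real \<Rightarrow> real \<Rightarrow> real \<Rightarrow> real \<Rightarrow> ('m \<times> 'm tvec) bilin \<Rightarrow> bool" where
  "g_natural_metric A g nabla a b c d G \<longleftrightarrow>
     symmetric_tensor (unit_tangent_bundle A g) G \<and>
     (\<forall>(x, u)\<in>pts (unit_tangent_bundle A g).
        let M\<^sub>x = tangent_space (manifold_space A) x;
            P = {Y \<in> M\<^sub>x. g x Y u = 0};
            h = unit_horizontal_lift A g nabla (x, u);
            v = unit_vertical_lift A g (x, u) in
        (\<forall>X1\<in>M\<^sub>x. \<forall>X2\<in>M\<^sub>x.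
           G (x, u) (h X1) (h X2) = (a + c) * g x X1 X2 + d * g x X1 u * g x X2 u) \<and>
        (\<forall>X1\<in>M\<^sub>x. \<forall>Y1\<in>P. G (x, u) (h X1) (v Y1) = b * g x X1 Y1) \<and>
        (\<forall>Y1\<in>P. \<forall>Y2\<in>P. G (x, u) (v Y1) (v Y2) = a * g x Y1 Y2))"

definition g_natural_paracontact_with ::
    "('m, real ^ 'n::finite) chart set \<Rightarrow> 'm bilin \<Rightarrow> ('m field \<Rightarrow> 'm field \<Rightarrow> 'm field) \<Rightarrow> nat
       \<Rightarrow> real \<Rightarrow> real \<Rightarrow> real \<Rightarrow> real \<Rightarrow> real \<Rightarrow> ('m \<times> 'm tvec) pc_structure \<Rightarrow> bool" where
  "g_natural_paracontact_with A g nabla n a b c d \<rho> S \<longleftrightarrow>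
     (case S of (\<phi>, \<xi>, \<eta>, G) \<Rightarrow>
       (let \<alpha> = a * (a + c) - b\<^sup>2; \<Phi> = a * (a + c + d) - b\<^sup>2 in
        paracontact_metric_structure (unit_tangent_bundle A g) n (\<phi>, \<xi>, \<eta>, G) \<and>
        g_natural_metric A g nabla a b c d G \<and>
        a + c + d = - 4 * \<alpha> \<and> - 4 * \<alpha> = 1 / \<rho>\<^sup>2 \<and>
        (\<forall>(x, u)\<in>pts (unit_tangent_bundle A g).
           let h = unit_horizontal_lift A g nabla (x, u);
               \<tau> = tangential_lift A g nabla a b c d (x, u) in
           \<xi> (x, u) = \<rho> *\<^sub>T h u \<and>
           (\<forall>X\<in>tangent_space (manifold_space A) x.
              \<eta> (x, u) (h X) = 1 / \<rho> * g x X u \<and>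
              \<eta> (x, u) (\<tau> X) = b * \<rho> * g x X u \<and>
              \<phi> (x, u) (h X) = (1 / (2 * \<rho> * \<alpha>)) *\<^sub>T
                (- b *\<^sub>T h X + (a + c) *\<^sub>T \<tau> X + (b * d / (a + c + d) * g x X u) *\<^sub>T h u) \<and>
              \<phi> (x, u) (\<tau> X) = (1 / (2 * \<rho> * \<alpha>)) *\<^sub>T
                (- a *\<^sub>T h X + b *\<^sub>T \<tau> X + (\<Phi> / (a + c + d) * g x X u) *\<^sub>T h u)))))"

definition g_natural_paracontact_metric_structure ::
    "('m, real ^ 'n::finite) chart set \<Rightarrow> 'm bilin \<Rightarrow> ('m field \<Rightarrow> 'm field \<Rightarrow> 'm field) \<Rightarrow> nat
       \<Rightarrow> ('m \<times> 'm tvec) pc_structure \<Rightarrow> bool" where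
  "g_natural_paracontact_metric_structure A g nabla n S \<longleftrightarrow>
     (\<exists>a b c d \<rho>. \<rho> > 0 \<and> g_natural_paracontact_with A g nabla n a b c d \<rho> S)"

text \<open>
  The variant without the sign condition on \<open>\<rho>\<close>.  A \<open>D\<^sub>t\<close>-homothetic deformation replaces \<open>\<rho>\<close> by
  \<open>\<rho> / t\<close>, so a negative \<open>t\<close> leads out of the class with \<open>\<rho> > 0\<close> but not out of this one.
\<close>

definition signed_g_natural_paracontact_metric_structure ::
    "('m, real ^ 'n::finite) chart set \<Rightarrow> 'm bilin \<Rightarrow> ('m field \<Rightarrow> 'm field \<Rightarrow> 'm field) \<Rightarrow> nat
       \<Rightarrow> ('m \<times> 'm tvec) pc_structure \<Rightarrow> bool" where
  "signed_g_natural_paracontact_metric_structure A g nabla n S \<longleftrightarrow>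
     (\<exists>a b c d \<rho>. \<rho> \<noteq> 0 \<and> g_natural_paracontact_with A g nabla n a b c d \<rho> S)"

end

theory Submission
  imports Defs
begin

text \<open>
  The deformed structure is \<open>g\<close>-natural with constants \<open>t a\<close>, \<open>t b\<close>, \<open>t c\<close>,
  \<open>t d + t (t - 1) / \<rho>\<^sup>2\<close> and with \<open>\<rho> / t\<close> in place of \<open>\<rho>\<close>: the term \<open>\<eta> \<otimes> \<eta>\<close> only affects pairs of
  horizontal vectors, as \<open>\<eta>\<close> vanishes on vertical ones, and there it contributes to the
  coefficient \<open>d\<close>.  The tangential lift depends on the constants and changes by a multiple of \<open>u\<^sup>h\<close>,
  on which \<open>\<phi>\<close> and \<open>\<eta>\<close> are known because \<open>u\<^sup>h\<close> is a multiple of \<open>\<xi>\<close>.  Since \<open>\<phi>\<close> and \<open>\<eta>\<close> are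
  additive only on derivations, one must know that the vertical lifts are derivations on the unit
  tangent bundle.  This needs the smoothness of the retraction \<open>u \<mapsto> u / |u|\<close>, and hence that
  derivations are determined by their components in a chart.
\<close>

section \<open>Smooth maps\<close>

text \<open>Origin of the constants: \<open>\<xi>\<close> is divided by \<open>t\<close>, so \<rho>
  becomes \<open>\<rho> / t\<close>; \<open>\<alpha>\<close> is quadratic in \<open>a\<close>,
  \<open>b\<close>, \<open>c\<close> and is multiplied by \<open>t\<^sup>2\<close>; and because
  \<open>a + c + d = 1 / \<rho>\<^sup>2\<close>, the correction of \<open>d\<close> makes
  \<open>a + c + d\<close> scale by \<open>t\<^sup>2\<close> too. So
  \<open>a + c + d = - 4 * \<alpha> = 1 / \<rho>\<^sup>2\<close> survives. The quotient
  \<open>\<rho> / t\<close> keeps the sign of \<rho> only for \<open>t > 0\<close>, whence the two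
  halves of the conclusion. Most of the length is owed to tangent vectors being derivations on
  germs. A tangent chart records a vector only through its components, so a function on the tangent
  bundle can be examined in coordinates only once the components give the derivation back;
  Hadamard's lemma supplies this. The vertical lift then becomes differentiation along the
  normalised line \<open>u + s *\<^sub>T Y\<close>, and the rules for real derivatives apply. That
  the lift \<open>u\<^sup>h\<close> is a derivation follows instead from its being
  \<open>1 / \<rho>\<close> times the vector field \<open>\<xi>\<close>.\<close>

lemma Ck_on_SucD:
  assumes "Ck_on (Suc k) S f"
  shows "x \<in> S \<Longrightarrow> (f has_derivative frechet_derivative f (at x)) (at x)"
    and "Ck_on k S (\<lambda>x. frechet_derivative f (at x) v)"
  using assms by (auto simp: frechet_derivative_works)

lemma Ck_on_cong:
  assumes "open S" "\<And>x. x \<in> S \<Longrightarrow> f x = g x" "Ck_on k S f"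
  shows "Ck_on k S g"
  using assms(2,3)
proof (induction k arbitrary: f g)
  case 0
  then show ?case by (metis Ck_on.simps(1) continuous_on_cong)
next
  case (Suc k)
  have d: "(g has_derivative frechet_derivative f (at x)) (at x)" if "x \<in> S" for x
    using has_derivative_transform_within_open[OF Ck_on_SucD(1)[OF Suc.prems(2) that] assms(1) that] Suc.prems(1)
    by blast
  have "Ck_on k S (\<lambda>x. frechet_derivative g (at x) v)" for v
    by (rule Suc.IH[OF _ Ck_on_SucD(2)[OF Suc.prems(2), of v]]) (metis d frechet_derivative_at)
  then show ?case using d by (auto simp: differentiable_def)
qed

text \<open>Lets a derivative be given by a formula instead of through
  \<open>frechet_derivative\<close>; the inductions on the order of differentiability rest on
  it.\<close>

lemma Ck_on_SucI:
  assumes "open S" "\<And>x. x \<in> S \<Longrightarrow> (f has_derivative f' x) (at x)" "\<And>v. Ck_on k S (\<lambda>x. f' x v)"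
  shows "Ck_on (Suc k) S f"
proof -
  have "Ck_on k S (\<lambda>x. frechet_derivative f (at x) v)" for v
    by (rule Ck_on_cong[OF assms(1) _ assms(3)[of v]]) (metis assms(2) frechet_derivative_at)
  then show ?thesis using assms(2) by (auto simp: differentiable_def)
qed

lemma Ck_on_subset: "Ck_on k S f \<Longrightarrow> T \<subseteq> S \<Longrightarrow> Ck_on k T f"
  by (induction k arbitrary: f) (auto intro: continuous_on_subset)

lemma Ck_on_continuous: "Ck_on k S f \<Longrightarrow> continuous_on S f"
  by (cases k) (auto intro!: continuous_at_imp_continuous_on differentiable_imp_continuous_within)

lemma Ck_on_Suc_imp: "Ck_on (Suc k) S f \<Longrightarrow> Ck_on k S f"
proof (induction k arbitrary: f)
  case 0
  then show ?case using Ck_on_continuous[OF 0] by simp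
next
  case (Suc k)
  then show ?case by simp
qed

lemma Ck_on_const:
  assumes "open S"
  shows "Ck_on k S (\<lambda>x. c)"
proof (induction k arbitrary: c)
  case (Suc k)
  show ?case by (rule Ck_on_SucI[OF assms has_derivative_const Suc.IH])
qed simp

lemma Ck_on_add:
  assumes "open S"
  shows "Ck_on k S f \<Longrightarrow> Ck_on k S g \<Longrightarrow> Ck_on k S (\<lambda>x. f x + g x)"
proof (induction k arbitrary: f g)
  case 0
  then show ?case by (auto intro: continuous_intros)
next
  case (Suc k)
  show ?case
    by (rule Ck_on_SucI[OF assms has_derivative_add[OF Ck_on_SucD(1)[OF Suc.prems(1)] Ck_on_SucD(1)[OF Suc.prems(2)]]
          Suc.IH[OF Ck_on_SucD(2)[OF Suc.prems(1)] Ck_on_SucD(2)[OF Suc.prems(2)]]])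
qed

lemma Ck_on_sum:
  "open S \<Longrightarrow> (\<And>i. i \<in> I \<Longrightarrow> Ck_on k S (f i)) \<Longrightarrow> Ck_on k S (\<lambda>x. \<Sum>i\<in>I. f i x)"
  by (induction I rule: infinite_finite_induct) (auto intro: Ck_on_add Ck_on_const)

lemma Ck_on_bounded_linear:
  assumes "open S" "bounded_linear h"
  shows "Ck_on k S f \<Longrightarrow> Ck_on k S (\<lambda>x. h (f x))"
proof (induction k arbitrary: f)
  case 0
  then show ?case by (auto intro: bounded_linear.continuous_on[OF assms(2)])
next
  case (Suc k)
  show ?case
    by (rule Ck_on_SucI[OF assms(1) bounded_linear.has_derivative[OF assms(2) Ck_on_SucD(1)[OF Suc.prems]]
          Suc.IH[OF Ck_on_SucD(2)[OF Suc.prems]]])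
qed

lemma Ck_on_linear_map:
  assumes "open S" "bounded_linear h"
  shows "Ck_on k S h"
proof (cases k)
  case 0
  then show ?thesis using assms(2) by (simp add: linear_continuous_on)
next
  case (Suc l)
  show ?thesis
    unfolding Suc by (rule Ck_on_SucI[OF assms(1) bounded_linear_imp_has_derivative[OF assms(2)] Ck_on_const[OF assms(1)]])
qed

text \<open>The product rule pairs each factor with a derivative of the other, so the induction
  hypothesis is also applied to the undifferentiated factors, one order lower.\<close>

lemma Ck_on_bilinear:
  assumes "open S" "bounded_bilinear B"
  shows "Ck_on k S f \<Longrightarrow> Ck_on k S g \<Longrightarrow> Ck_on k S (\<lambda>x. B (f x) (g x))"
proof (induction k arbitrary: f g)
  case 0
  then show ?case by (auto intro: bounded_bilinear.continuous_on[OF assms(2)])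
next
  case (Suc k)
  show ?case
    by (rule Ck_on_SucI[OF assms(1) bounded_bilinear.FDERIV[OF assms(2) Ck_on_SucD(1)[OF Suc.prems(1)] Ck_on_SucD(1)[OF Suc.prems(2)]]
       Ck_on_add[OF assms(1) Suc.IH[OF Ck_on_Suc_imp[OF Suc.prems(1)] Ck_on_SucD(2)[OF Suc.prems(2)]]
         Suc.IH[OF Ck_on_SucD(2)[OF Suc.prems(1)] Ck_on_Suc_imp[OF Suc.prems(2)]]]])
qed

text \<open>In the chain rule \<open>x\<close> enters both the linear map and its argument.
  Expanding the argument in the basis turns this into sums of products of a scalar with a partial
  derivative of \<open>f\<close> composed with \<open>g\<close>, to which the induction hypothesis
  applies.\<close>

lemma Ck_on_compose:
  fixes g :: "'a::euclidean_space \<Rightarrow> 'b::euclidean_space"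
  assumes "open S" "g ` S \<subseteq> T"
  shows "Ck_on k S g \<Longrightarrow> Ck_on k T f \<Longrightarrow> Ck_on k S (\<lambda>x. f (g x))"
proof (induction k arbitrary: f)
  case 0
  then show ?case using assms by (auto intro: continuous_on_compose2)
next
  case (Suc k)
  let ?f' = "\<lambda>y. frechet_derivative f (at y)" and ?g' = "\<lambda>x. frechet_derivative g (at x)"
  have d: "((\<lambda>x. f (g x)) has_derivative (\<lambda>v. \<Sum>b\<in>Basis. (?g' x v \<bullet> b) *\<^sub>R ?f' (g x) b)) (at x)"
    if "x \<in> S" for x
  proof -
    have gx: "g x \<in> T" using that assms by auto
    have l: "linear (?f' (g x))"
      using Ck_on_SucD(1)[OF Suc.prems(2) gx] by (rule has_derivative_linear)
    have "?f' (g x) w = (\<Sum>b\<in>Basis. (w \<bullet> b) *\<^sub>R ?f' (g x) b)" for w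
      using arg_cong[OF euclidean_representation[of w], of "?f' (g x)"]
      by (simp add: linear_sum[OF l] linear_scale[OF l] del: euclidean_representation)
    then have "(\<lambda>v. ?f' (g x) (?g' x v)) = (\<lambda>v. \<Sum>b\<in>Basis. (?g' x v \<bullet> b) *\<^sub>R ?f' (g x) b)"
      by blast
    then show ?thesis
      using has_derivative_compose[OF Ck_on_SucD(1)[OF Suc.prems(1) that] Ck_on_SucD(1)[OF Suc.prems(2) gx]]
      by (simp only:)
  qed
  show ?case
  proof (rule Ck_on_SucI[OF assms(1) d], assumption)
    fix v
    show "Ck_on k S (\<lambda>x. \<Sum>b\<in>Basis. (?g' x v \<bullet> b) *\<^sub>R ?f' (g x) b)"
    proof (rule Ck_on_sum[OF assms(1)], rule Ck_on_bilinear[OF assms(1) bounded_bilinear_scaleR])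
      fix b :: 'b
      show "Ck_on k S (\<lambda>x. ?g' x v \<bullet> b)"
        by (rule Ck_on_bounded_linear[OF assms(1) bounded_linear_inner_left Ck_on_SucD(2)[OF Suc.prems(1)]])
      show "Ck_on k S (\<lambda>x. ?f' (g x) b)"
        by (rule Suc.IH[OF Ck_on_Suc_imp[OF Suc.prems(1)] Ck_on_SucD(2)[OF Suc.prems(2)]])
    qed
  qed
qed

text \<open>With an arbitrary factor and exponent the family is closed under differentiation, which
  is what the induction needs.\<close>

lemma Ck_on_powr: "Ck_on k {0<..} (\<lambda>r::real. c * r powr s)"
proof (induction k arbitrary: c s)
  case 0
  show ?case by (auto intro!: continuous_intros)
next
  case (Suc k)
  show ?case
  proof (rule Ck_on_SucI)
    show "((\<lambda>r. c * r powr s) has_derivative (\<lambda>v. (c * s * v) * x powr (s - 1))) (at x)" if "x \<in> {0<..}" for x :: real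
    proof -
      have "((\<lambda>r. c * r powr s) has_real_derivative (c * s * x powr (s - 1))) (at x)"
        using that by (auto intro!: derivative_eq_intros)
      moreover have "(\<lambda>v. (c * s * v) * x powr (s - 1)) = (*) (c * s * x powr (s - 1))"
        by auto
      ultimately show ?thesis by (simp only: has_field_derivative_def)
    qed
    show "Ck_on k {0<..} (\<lambda>x. c * s * v * x powr (s - 1))" for v by (rule Suc.IH)
  qed simp
qed

lemma smooth_on_subset: "smooth_on S f \<Longrightarrow> T \<subseteq> S \<Longrightarrow> smooth_on T f"
  unfolding smooth_on_def using Ck_on_subset by blast

lemma smooth_on_cong:
  assumes "open S" "\<And>x. x \<in> S \<Longrightarrow> f x = g x" "smooth_on S f"
  shows "smooth_on S g"
  using assms(3) Ck_on_cong[OF assms(1,2)] by (simp add: smooth_on_def)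

lemma smooth_on_const: "open S \<Longrightarrow> smooth_on S (\<lambda>x. c)"
  unfolding smooth_on_def by (rule allI, rule Ck_on_const; simp)

lemma smooth_on_add:
  "open S \<Longrightarrow> smooth_on S f \<Longrightarrow> smooth_on S g \<Longrightarrow> smooth_on S (\<lambda>x. f x + g x)"
  unfolding smooth_on_def by (rule allI, rule Ck_on_add; simp)

lemma smooth_on_sum:
  "open S \<Longrightarrow> (\<And>i. i \<in> I \<Longrightarrow> smooth_on S (f i)) \<Longrightarrow> smooth_on S (\<lambda>x. \<Sum>i\<in>I. f i x)"
  unfolding smooth_on_def by (rule allI, rule Ck_on_sum; simp)

lemma smooth_on_linear_map: "open S \<Longrightarrow> bounded_linear h \<Longrightarrow> smooth_on S h"
  unfolding smooth_on_def by (rule allI, rule Ck_on_linear_map; simp)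

lemma smooth_on_bounded_linear:
  "open S \<Longrightarrow> bounded_linear h \<Longrightarrow> smooth_on S f \<Longrightarrow> smooth_on S (\<lambda>x. h (f x))"
  unfolding smooth_on_def by (rule allI, rule Ck_on_bounded_linear; simp)

lemma smooth_on_bilinear:
  "open S \<Longrightarrow> bounded_bilinear B \<Longrightarrow> smooth_on S f \<Longrightarrow> smooth_on S g \<Longrightarrow>
    smooth_on S (\<lambda>x. B (f x) (g x))"
  unfolding smooth_on_def by (rule allI, rule Ck_on_bilinear; simp)

lemma smooth_on_compose:
  fixes g :: "'a::euclidean_space \<Rightarrow> 'b::euclidean_space"
  shows "open S \<Longrightarrow> g ` S \<subseteq> T \<Longrightarrow> smooth_on S g \<Longrightarrow> smooth_on T f \<Longrightarrow> smooth_on S (\<lambda>x. f (g x))"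
  unfolding smooth_on_def by (rule allI, rule Ck_on_compose[where T=T]; simp)

lemma smooth_on_Pair:
  fixes f :: "_ \<Rightarrow> 'b::euclidean_space" and g :: "_ \<Rightarrow> 'c::euclidean_space"
  assumes "open S" "smooth_on S f" "smooth_on S g"
  shows "smooth_on S (\<lambda>x. (f x, g x))"
proof -
  have "smooth_on S (\<lambda>x. (f x, 0::'c) + (0::'b, g x))"
    by (rule smooth_on_add[OF assms(1) smooth_on_bounded_linear[OF assms(1) _ assms(2)]
          smooth_on_bounded_linear[OF assms(1) _ assms(3)]])
      (intro bounded_linear_Pair bounded_linear_ident bounded_linear_zero)+
  then show ?thesis by simp
qed

lemma smooth_on_continuous: "smooth_on S f \<Longrightarrow> continuous_on S f"
  unfolding smooth_on_def by (rule Ck_on_continuous[of 0]) blast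

lemma smooth_on_has_derivative:
  "smooth_on S f \<Longrightarrow> x \<in> S \<Longrightarrow> (f has_derivative frechet_derivative f (at x)) (at x)"
  unfolding smooth_on_def by (rule Ck_on_SucD(1)[of 0]) blast+

lemma smooth_on_frechet_derivative:
  "smooth_on S f \<Longrightarrow> smooth_on S (\<lambda>x. frechet_derivative f (at x) v)"
  unfolding smooth_on_def by (rule allI, rule Ck_on_SucD(2)) blast

lemma smooth_on_inverse_sqrt: "smooth_on {0<..} (\<lambda>r::real. 1 / sqrt r)"
proof -
  have "smooth_on {0<..} (\<lambda>r::real. 1 * r powr (-1/2))"
    unfolding smooth_on_def by (rule allI, rule Ck_on_powr)
  then show ?thesis
    by (rule smooth_on_cong[rotated -1]) (auto simp: powr_minus_divide powr_half_sqrt)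
qed

section \<open>Hadamard's lemma\<close>

lemma segment_point_in_convex:
  fixes p x :: "'a::real_vector"
  assumes "convex S" "p \<in> S" "x \<in> S" "t \<in> {0..1}"
  shows "p + t *\<^sub>R (x - p) \<in> S"
proof -
  have "p + t *\<^sub>R (x - p) = (1 - t) *\<^sub>R p + t *\<^sub>R x" by (simp add: algebra_simps)
  then show ?thesis using convexD_alt[OF assms(1,2,3), of t] assms(4) by simp
qed

lemma continuous_on_segment:
  fixes f :: "'a::euclidean_space \<Rightarrow> real"
  assumes "convex S" "p \<in> S" "continuous_on S f"
  shows "continuous_on (S \<times> cbox 0 1) (\<lambda>(x, t). t ^ m * f (p + t *\<^sub>R (x - p)))"
  unfolding split_beta
  by (intro continuous_intros continuous_on_compose2[OF assms(3)])
    (auto intro!: continuous_intros segment_point_in_convex assms)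

text \<open>Differentiating under the integral in \<open>x\<close> produces a factor
  \<open>t\<close> by the chain rule; the weight \<open>t ^ m\<close> with arbitrary
  \<open>m\<close> absorbs it.\<close>

lemma Ck_on_segment_integral:
  fixes f :: "'a::euclidean_space \<Rightarrow> real"
  assumes S: "open S" "convex S" "p \<in> S"
  shows "Ck_on k S f \<Longrightarrow> Ck_on k S (\<lambda>x. integral {0..1} (\<lambda>t. t ^ m * f (p + t *\<^sub>R (x - p))))"
proof (induction k arbitrary: f m)
  case 0
  then have "continuous_on S (\<lambda>x. integral (cbox 0 1) (\<lambda>t. t ^ m * f (p + t *\<^sub>R (x - p))))"
    using continuous_on_segment[OF S(2,3)] by (intro integral_continuous_on_param) auto
  then show ?case by simp
next
  case (Suc k)
  define f' where "f' y = frechet_derivative f (at y)" for y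
  note f = Ck_on_SucD[OF Suc.prems, folded f'_def]
  \<comment> \<open>\<open>leibniz_rule\<close> takes the derivative as a continuous map into the
    bounded linear functionals. It is assembled from the partial derivatives, whose continuity is
    known one by one.\<close>
  define L where "L x t = (\<Sum>b\<in>Basis. (t ^ Suc m * f' (p + t *\<^sub>R (x - p)) b) *\<^sub>R blinfun_inner_left b)" for x t
  have L: "blinfun_apply (L x t) v = t ^ Suc m * f' (p + t *\<^sub>R (x - p)) v"
    if "x \<in> S" "t \<in> cbox 0 1" for x t v
  proof -
    have l: "linear (f' (p + t *\<^sub>R (x - p)))"
      using f(1)[OF segment_point_in_convex[OF S(2,3) that(1)]] that(2) by (auto intro: has_derivative_linear)
    have "f' (p + t *\<^sub>R (x - p)) v = (\<Sum>b\<in>Basis. (v \<bullet> b) *\<^sub>R f' (p + t *\<^sub>R (x - p)) b)"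
      using arg_cong[OF euclidean_representation[of v], of "f' (p + t *\<^sub>R (x - p))"]
      by (simp add: linear_sum[OF l] linear_scale[OF l] del: euclidean_representation)
    then show ?thesis
      by (simp add: L_def blinfun.sum_left blinfun.scaleR_left blinfun_inner_left.rep_eq sum_distrib_left
          inner_commute mult_ac)
  qed
  have contL: "continuous_on (S \<times> cbox 0 1) (\<lambda>(x, t). L x t)"
  proof -
    have "continuous_on (S \<times> cbox 0 1) (\<lambda>z. snd z ^ Suc m * f' (p + snd z *\<^sub>R (fst z - p)) b)" for b
      using continuous_on_segment[OF S(2,3) Ck_on_continuous[OF f(2)[of b]], of "Suc m"]
      by (simp only: case_prod_unfold)
    then show ?thesis
      unfolding L_def split_beta
      by (intro continuous_on_sum continuous_on_scaleR continuous_on_const)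
  qed
  have pair: "continuous_on (cbox (0::real) 1) (\<lambda>t. (y, t))" "(\<lambda>t. (y, t)) ` cbox 0 1 \<subseteq> S \<times> cbox 0 1"
    if "y \<in> S" for y
    using that by (auto intro: continuous_intros)
  have d: "((\<lambda>x. integral {0..1} (\<lambda>t. t ^ m * f (p + t *\<^sub>R (x - p)))) has_derivative
      (\<lambda>v. integral {0..1} (\<lambda>t. t ^ Suc m * f' (p + t *\<^sub>R (x - p)) v))) (at x)" if x: "x \<in> S" for x
  proof -
    have "((\<lambda>x. integral (cbox 0 1) (\<lambda>t. t ^ m * f (p + t *\<^sub>R (x - p)))) has_derivative
        integral (cbox 0 1) (L x)) (at x within S)"
    proof (rule leibniz_rule[OF _ _ contL x S(2)])
      fix y :: 'a and t :: real assume y: "y \<in> S" and t: "t \<in> cbox 0 1"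
      have "(f has_derivative f' (p + t *\<^sub>R (y - p))) (at (p + t *\<^sub>R (y - p)))"
        using f(1)[OF segment_point_in_convex[OF S(2,3) y]] t by auto
      moreover have "((\<lambda>y. p + t *\<^sub>R (y - p)) has_derivative (\<lambda>v. t *\<^sub>R v)) (at y within S)"
        by (auto intro!: derivative_eq_intros)
      ultimately have "((\<lambda>y. f (p + t *\<^sub>R (y - p))) has_derivative (\<lambda>v. f' (p + t *\<^sub>R (y - p)) (t *\<^sub>R v))) (at y within S)"
        by (rule has_derivative_compose[rotated])
      then have "((\<lambda>y. t ^ m * f (p + t *\<^sub>R (y - p))) has_derivative
          (\<lambda>v. t ^ m * f' (p + t *\<^sub>R (y - p)) (t *\<^sub>R v))) (at y within S)"
        by (rule has_derivative_mult_right)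
      moreover have "blinfun_apply (L y t) = (\<lambda>v. t ^ m * f' (p + t *\<^sub>R (y - p)) (t *\<^sub>R v))"
      proof
        fix v
        have "linear (f' (p + t *\<^sub>R (y - p)))"
          using f(1)[OF segment_point_in_convex[OF S(2,3) y]] t by (auto intro: has_derivative_linear)
        then show "blinfun_apply (L y t) v = t ^ m * f' (p + t *\<^sub>R (y - p)) (t *\<^sub>R v)"
          by (simp add: L[OF y t] linear_scale mult_ac)
      qed
      ultimately show "((\<lambda>y. t ^ m * f (p + t *\<^sub>R (y - p))) has_derivative blinfun_apply (L y t)) (at y within S)"
        by simp
    next
      fix y assume y: "y \<in> S"
      have "continuous_on (cbox 0 1) (\<lambda>t. t ^ m * f (p + t *\<^sub>R (y - p)))"
        using continuous_on_compose2[OF continuous_on_segment[OF S(2,3) Ck_on_continuous[OF Suc.prems], of m] pair[OF y]]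
        by (simp only: prod.case)
      then show "(\<lambda>t. t ^ m * f (p + t *\<^sub>R (y - p))) integrable_on cbox 0 1"
        by (rule integrable_continuous)
    qed
    moreover have "blinfun_apply (integral (cbox 0 1) (L x))
        = (\<lambda>v. integral {0..1} (\<lambda>t. t ^ Suc m * f' (p + t *\<^sub>R (x - p)) v))"
    proof
      fix v
      have "continuous_on (cbox 0 1) (L x)"
        using continuous_on_compose2[OF contL pair[OF x]] by (simp only: prod.case)
      then have "L x integrable_on cbox 0 1" by (rule integrable_continuous)
      then have "blinfun_apply (integral (cbox 0 1) (L x)) v = integral (cbox 0 1) (\<lambda>t. blinfun_apply (L x t) v)"
        by (rule blinfun_apply_integral)
      also have "\<dots> = integral (cbox 0 1) (\<lambda>t. t ^ Suc m * f' (p + t *\<^sub>R (x - p)) v)"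
        by (rule integral_cong) (rule L[OF x])
      finally show "blinfun_apply (integral (cbox 0 1) (L x)) v
        = integral {0..1} (\<lambda>t. t ^ Suc m * f' (p + t *\<^sub>R (x - p)) v)" by simp
    qed
    ultimately show ?thesis using at_within_open[OF x S(1)] by (simp del: power_Suc)
  qed
  show ?case by (rule Ck_on_SucI[OF S(1) d Suc.IH[OF f(2)]])
qed

text \<open>The fundamental theorem of calculus along the segment from \<open>p\<close> to
  \<open>x\<close> writes the increment of \<open>f\<close> as an integral of directional
  derivatives; \<open>H b\<close> is the mean of the partial derivative along that segment.\<close>

lemma smooth_on_hadamard:
  fixes f :: "'a::euclidean_space \<Rightarrow> real"
  assumes S: "open S" "convex S" "p \<in> S" and f: "smooth_on S f"
  obtains H where "\<And>b. smooth_on S (H b)" "\<And>b. H b p = frechet_derivative f (at p) b"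
    "\<And>x. x \<in> S \<Longrightarrow> f x = f p + (\<Sum>b\<in>Basis. ((x - p) \<bullet> b) * H b x)"
proof
  define f' where "f' y = frechet_derivative f (at y)" for y
  note f' = smooth_on_has_derivative[OF f, folded f'_def]
  define H where "H b x = integral {0..1} (\<lambda>t. t ^ 0 * f' (p + t *\<^sub>R (x - p)) b)" for b x
  show "smooth_on S (H b)" for b
    using smooth_on_frechet_derivative[OF f, of b, folded f'_def]
    unfolding smooth_on_def H_def by (intro allI Ck_on_segment_integral[OF S]) simp
  show "H b p = frechet_derivative f (at p) b" for b
    by (simp add: H_def f'_def)
  show "f x = f p + (\<Sum>b\<in>Basis. ((x - p) \<bullet> b) * H b x)" if x: "x \<in> S" for x
  proof -
    have sp: "p + t *\<^sub>R (x - p) \<in> S" if "t \<in> {0..1}" for t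
      by (rule segment_point_in_convex[OF S(2,3) x that])
    have e: "f' (p + t *\<^sub>R (x - p)) (x - p) = (\<Sum>b\<in>Basis. ((x - p) \<bullet> b) * f' (p + t *\<^sub>R (x - p)) b)"
      if "t \<in> {0..1}" for t
    proof -
      have l: "linear (f' (p + t *\<^sub>R (x - p)))"
        using f'[OF sp[OF that]] by (rule has_derivative_linear)
      show ?thesis
        using arg_cong[OF euclidean_representation[of "x - p"], of "f' (p + t *\<^sub>R (x - p))"]
        by (simp add: linear_sum[OF l] linear_scale[OF l] del: euclidean_representation)
    qed
    have "((\<lambda>t. f' (p + t *\<^sub>R (x - p)) (x - p)) has_integral
        f (p + 1 *\<^sub>R (x - p)) - f (p + 0 *\<^sub>R (x - p))) {0..1}"
    proof (rule fundamental_theorem_of_calculus)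
      fix t :: real assume t: "t \<in> {0..1}"
      have "((\<lambda>t. p + t *\<^sub>R (x - p)) has_derivative (\<lambda>s. s *\<^sub>R (x - p))) (at t within {0..1})"
        by (auto intro!: derivative_eq_intros)
      from has_derivative_compose[OF this f'[OF sp[OF t]]]
      show "((\<lambda>t. f (p + t *\<^sub>R (x - p))) has_vector_derivative f' (p + t *\<^sub>R (x - p)) (x - p)) (at t within {0..1})"
        using has_derivative_linear[OF f'[OF sp[OF t]]]
        by (simp add: has_vector_derivative_def linear_scale)
    qed simp
    then have "f x - f p = integral {0..1} (\<lambda>t. f' (p + t *\<^sub>R (x - p)) (x - p))"
      by (simp add: integral_unique)
    also have "\<dots> = integral {0..1} (\<lambda>t. \<Sum>b\<in>Basis. ((x - p) \<bullet> b) * f' (p + t *\<^sub>R (x - p)) b)"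
      by (rule integral_cong) (rule e)
    also have "\<dots> = (\<Sum>b\<in>Basis. ((x - p) \<bullet> b) * H b x)"
    proof -
      have "(\<lambda>t. f' (p + t *\<^sub>R (x - p)) b) integrable_on {0..1}" for b
      proof (rule integrable_continuous_interval)
        show "continuous_on {0..1} (\<lambda>t. f' (p + t *\<^sub>R (x - p)) b)"
          by (rule continuous_on_compose2[OF smooth_on_continuous[OF smooth_on_frechet_derivative[OF f, of b, folded f'_def]]])
            (use sp in \<open>auto intro!: continuous_intros\<close>)
      qed
      then show ?thesis
        by (subst integral_sum) (auto simp: H_def integrable_on_mult_right)
    qed
    finally show ?thesis by simp
  qed
qed

section \<open>Smooth functions and derivations\<close>

lemma tscale_apply [simp]: "(c *\<^sub>T D) f = c * D f"
  by (simp add: tscale_def)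

lemma tscale_zero [simp]: "0 *\<^sub>T D = 0"
  by (simp add: tscale_def zero_fun_def)

lemma tscale_one [simp]: "1 *\<^sub>T D = D"
  by (simp add: tscale_def)

lemma tscale_tscale [simp]: "a *\<^sub>T b *\<^sub>T D = (a * b) *\<^sub>T D"
  by (simp add: tscale_def mult.assoc)

lemma tangent_spaceD:
  assumes "D \<in> tangent_space X p"
  shows "smooth_at X p f \<Longrightarrow> smooth_at X p g \<Longrightarrow> D (\<lambda>q. f q + g q) = D f + D g"
    and "smooth_at X p f \<Longrightarrow> smooth_at X p g \<Longrightarrow> D (\<lambda>q. f q * g q) = f p * D g + g p * D f"
    and "smooth_at X p f \<Longrightarrow> D (\<lambda>q. c * f q) = c * D f"
    and "\<not> smooth_at X p f \<Longrightarrow> D f = 0"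
  using assms by (auto simp: tangent_space_def)

lemma tangent_space_add:
  assumes "D \<in> tangent_space X p" "E \<in> tangent_space X p"
  shows "D + E \<in> tangent_space X p"
  using assms by (simp add: tangent_space_def plus_fun_def algebra_simps)

lemma tangent_space_scale: "D \<in> tangent_space X p \<Longrightarrow> c *\<^sub>T D \<in> tangent_space X p"
  by (simp add: tangent_space_def algebra_simps)

lemma tangent_space_zero: "0 \<in> tangent_space X p"
  by (simp add: tangent_space_def)

text \<open>The clause of \<open>smooth_at (manifold_space A)\<close> for a single chart.\<close>

definition smooth_in_chart ::
  "('p, 'e::euclidean_space) chart \<Rightarrow> 'p \<Rightarrow> ('p \<Rightarrow> real) \<Rightarrow> bool" where
  "smooth_in_chart c p f \<longleftrightarrow> (\<exists>W. open W \<and> snd c p \<in> W \<and> W \<subseteq> snd c ` fst c \<and>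
     smooth_on W (f \<circ> inv_into (fst c) (snd c)))"

lemma smooth_in_chartI:
  assumes "open W" "snd c p \<in> W" "W \<subseteq> snd c ` fst c"
    and "smooth_on W (f \<circ> inv_into (fst c) (snd c))"
  shows "smooth_in_chart c p f"
  unfolding smooth_in_chart_def by (intro exI[of _ W] conjI assms)

lemma smooth_in_chartE:
  assumes "smooth_in_chart c p f"
  obtains W where "open W" "snd c p \<in> W" "W \<subseteq> snd c ` fst c"
    "smooth_on W (f \<circ> inv_into (fst c) (snd c))"
  using assms unfolding smooth_in_chart_def by (elim exE conjE) (rule that)

lemma smooth_at_manifold_space:
  "smooth_at (manifold_space A) p f \<longleftrightarrow> (\<forall>c\<in>A. p \<in> fst c \<longrightarrow> smooth_in_chart c p f)"
  by (simp add: manifold_space_def smooth_in_chart_def case_prod_unfold)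

lemma smooth_in_chart_add:
  assumes "smooth_in_chart c p f" "smooth_in_chart c p g"
  shows "smooth_in_chart c p (\<lambda>q. f q + g q)"
proof -
  obtain V where
    V: "open V" "snd c p \<in> V" "V \<subseteq> snd c ` fst c" "smooth_on V (f \<circ> inv_into (fst c) (snd c))"
    by (rule smooth_in_chartE[OF assms(1)])
  obtain W where
    W: "open W" "snd c p \<in> W" "W \<subseteq> snd c ` fst c" "smooth_on W (g \<circ> inv_into (fst c) (snd c))"
    by (rule smooth_in_chartE[OF assms(2)])
  have o: "open (V \<inter> W)" using V W by blast
  have "smooth_on (V \<inter> W) (\<lambda>y. (f \<circ> inv_into (fst c) (snd c)) y + (g \<circ> inv_into (fst c) (snd c)) y)"
    by (rule smooth_on_add[OF o smooth_on_subset[OF V(4) Int_lower1] smooth_on_subset[OF W(4) Int_lower2]])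
  then show ?thesis
    using V W by (intro smooth_in_chartI[where W="V \<inter> W"]) (auto simp: o_def)
qed

lemma smooth_in_chart_mult:
  assumes "smooth_in_chart c p f" "smooth_in_chart c p g"
  shows "smooth_in_chart c p (\<lambda>q. f q * g q)"
proof -
  obtain V where
    V: "open V" "snd c p \<in> V" "V \<subseteq> snd c ` fst c" "smooth_on V (f \<circ> inv_into (fst c) (snd c))"
    by (rule smooth_in_chartE[OF assms(1)])
  obtain W where
    W: "open W" "snd c p \<in> W" "W \<subseteq> snd c ` fst c" "smooth_on W (g \<circ> inv_into (fst c) (snd c))"
    by (rule smooth_in_chartE[OF assms(2)])
  have o: "open (V \<inter> W)" using V W by blast
  have "smooth_on (V \<inter> W) (\<lambda>y. (f \<circ> inv_into (fst c) (snd c)) y * (g \<circ> inv_into (fst c) (snd c)) y)"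
    by (rule smooth_on_bilinear[OF o bounded_bilinear_mult smooth_on_subset[OF V(4) Int_lower1] smooth_on_subset[OF W(4) Int_lower2]])
  then show ?thesis
    using V W by (intro smooth_in_chartI[where W="V \<inter> W"]) (auto simp: o_def)
qed

lemma smooth_in_chart_cmult:
  assumes "smooth_in_chart c p f"
  shows "smooth_in_chart c p (\<lambda>q. r * f q)"
proof -
  obtain W where
    W: "open W" "snd c p \<in> W" "W \<subseteq> snd c ` fst c" "smooth_on W (f \<circ> inv_into (fst c) (snd c))"
    by (rule smooth_in_chartE[OF assms])
  have "smooth_on W (\<lambda>y. r * (f \<circ> inv_into (fst c) (snd c)) y)"
    by (rule smooth_on_bounded_linear[OF W(1) bounded_linear_mult_right W(4)])
  then show ?thesis
    using W by (intro smooth_in_chartI[where W=W]) (auto simp: o_def)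
qed

text \<open>Stated for any set of charts, so that this rule and the next two also serve the tangent
  bundle and, through smooth extensions, the unit tangent bundle.\<close>

lemma smooth_at_add:
  "smooth_at (manifold_space A) p f \<Longrightarrow> smooth_at (manifold_space A) p g \<Longrightarrow>
    smooth_at (manifold_space A) p (\<lambda>q. f q + g q)"
  by (simp add: smooth_at_manifold_space smooth_in_chart_add)

lemma smooth_at_mult:
  "smooth_at (manifold_space A) p f \<Longrightarrow> smooth_at (manifold_space A) p g \<Longrightarrow>
    smooth_at (manifold_space A) p (\<lambda>q. f q * g q)"
  by (simp add: smooth_at_manifold_space smooth_in_chart_mult)

lemma smooth_at_cmult:
  "smooth_at (manifold_space A) p f \<Longrightarrow> smooth_at (manifold_space A) p (\<lambda>q. r * f q)"
  by (simp add: smooth_at_manifold_space smooth_in_chart_cmult)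

lemma open_preimage_Int:
  assumes "open S" "continuous_on S f" "open T"
  shows "open {x \<in> S. f x \<in> T}"
proof -
  have "{x \<in> S. f x \<in> T} = S \<inter> f -` T" by auto
  then show ?thesis using continuous_open_preimage[OF assms(2,1,3)] by simp
qed

section \<open>Tangent vectors in charts\<close>

locale smooth_atlas =
  fixes A :: "('m::{t2_space,second_countable_topology}, real ^ 'n::finite) chart set"
  assumes smooth_manifold: "smooth_manifold A"
begin

abbreviation M :: "'m smooth_space" where "M \<equiv> manifold_space A"

lemma pts_manifold [simp]: "pts M = UNIV"
  using smooth_manifold by (simp add: smooth_manifold_def manifold_space_def)

lemma obtain_chart:
  obtains U \<kappa> where "(U, \<kappa>) \<in> A" "x \<in> U"
proof -
  have "x \<in> \<Union> (fst ` A)" using smooth_manifold by (simp add: smooth_manifold_def)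
  then show ?thesis using that by auto
qed

lemma chart:
  assumes "(U, \<kappa>) \<in> A"
  shows open_chart_image: "open (\<kappa> ` U)" and inj_on_chart: "inj_on \<kappa> U"
    and open_chart_overlap: "(V, \<mu>) \<in> A \<Longrightarrow> open (\<kappa> ` (U \<inter> V))"
    and smooth_transition: "(V, \<mu>) \<in> A \<Longrightarrow> smooth_on (\<kappa> ` (U \<inter> V)) (\<mu> \<circ> inv_into U \<kappa>)"
proof -
  obtain \<iota> where U: "open U" "open (\<kappa> ` U)" "homeomorphism U (\<kappa> ` U) \<kappa> \<iota>"
    using smooth_manifold assms by (auto simp: smooth_manifold_def)
  show "open (\<kappa> ` U)" by (rule U(2))
  show "inj_on \<kappa> U"
    by (rule inj_on_inverseI) (rule homeomorphism_apply1[OF U(3)])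
  show "open (\<kappa> ` (U \<inter> V))" if V: "(V, \<mu>) \<in> A"
  proof -
    have "open V" using smooth_manifold V by (auto simp: smooth_manifold_def)
    then have "openin (top_of_set U) (U \<inter> V)" by (simp add: openin_open_Int)
    from homeomorphism_imp_open_map[OF U(3) this] show ?thesis
      using U(2) by (rule openin_open_trans)
  qed
  show "(V, \<mu>) \<in> A \<Longrightarrow> smooth_on (\<kappa> ` (U \<inter> V)) (\<mu> \<circ> inv_into U \<kappa>)"
    using smooth_manifold assms unfolding smooth_manifold_def by fast
qed

text \<open>Smoothness is demanded in every chart around \<open>p\<close>; a transition map carries
  it from one chart to the others.\<close>

lemma smooth_at_chartI:
  assumes c: "(U, \<kappa>) \<in> A" "p \<in> U" and f: "smooth_in_chart (U, \<kappa>) p f"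
  shows "smooth_at M p f"
proof -
  obtain W where W: "open W" "\<kappa> p \<in> W" "W \<subseteq> \<kappa> ` U" "smooth_on W (f \<circ> inv_into U \<kappa>)"
    by (rule smooth_in_chartE[OF f, unfolded fst_conv snd_conv])
  have "smooth_in_chart (V, \<mu>) p f" if V: "(V, \<mu>) \<in> A" "p \<in> V" for V \<mu>
  proof -
    \<comment> \<open>The part of the overlap, in the coordinates of the second chart, that the
      transition map sends into \<open>W\<close>.\<close>
    define W' where "W' = {z \<in> \<mu> ` (V \<inter> U). (\<kappa> \<circ> inv_into V \<mu>) z \<in> W}"
    note tr = smooth_transition[OF V(1) c(1)]
    have sub: "W' \<subseteq> \<mu> ` (V \<inter> U)" by (auto simp: W'_def)
    have opn: "open W'"
      unfolding W'_def
      by (rule open_preimage_Int[OF open_chart_overlap[OF V(1) c(1)] smooth_on_continuous[OF tr] W(1)])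
    have "smooth_on W' (\<lambda>z. (f \<circ> inv_into U \<kappa>) ((\<kappa> \<circ> inv_into V \<mu>) z))"
      by (rule smooth_on_compose[OF opn _ smooth_on_subset[OF tr sub] W(4)]) (auto simp: W'_def)
    then have "smooth_on W' (f \<circ> inv_into V \<mu>)"
      by (rule smooth_on_cong[OF opn, rotated])
        (use sub inj_on_chart[OF V(1)] inj_on_chart[OF c(1)] in auto)
    moreover have "\<mu> p \<in> W'" using c V W inj_on_chart[OF V(1)] by (auto simp: W'_def)
    ultimately show ?thesis
      using opn sub by (intro smooth_in_chartI[where W=W']) auto
  qed
  then show ?thesis by (auto simp: smooth_at_manifold_space)
qed

lemma smooth_at_chart_iff:
  assumes "(U, \<kappa>) \<in> A" "p \<in> U"
  shows "smooth_at M p f \<longleftrightarrow> smooth_in_chart (U, \<kappa>) p f"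
proof
  assume "smooth_at M p f"
  then show "smooth_in_chart (U, \<kappa>) p f"
    unfolding smooth_at_manifold_space using assms by (metis fst_conv)
qed (rule smooth_at_chartI[OF assms])

text \<open>The same \<open>W\<close> witnesses smoothness at every point over it. This last clause
  is what makes coordinate fields smooth.\<close>

lemma smooth_at_chartE:
  assumes c: "(U, \<kappa>) \<in> A" "p \<in> U" and f: "smooth_at M p f"
  obtains W where "open W" "\<kappa> p \<in> W" "W \<subseteq> \<kappa> ` U" "smooth_on W (f \<circ> inv_into U \<kappa>)"
    "\<And>y. y \<in> W \<Longrightarrow> smooth_at M (inv_into U \<kappa> y) f"
proof -
  obtain W where W: "open W" "\<kappa> p \<in> W" "W \<subseteq> \<kappa> ` U" "smooth_on W (f \<circ> inv_into U \<kappa>)"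
    by (rule smooth_in_chartE[OF f[unfolded smooth_at_chart_iff[OF c]], unfolded fst_conv snd_conv])
  have "smooth_at M (inv_into U \<kappa> y) f" if "y \<in> W" for y
  proof (rule smooth_at_chartI[OF c(1)])
    show "inv_into U \<kappa> y \<in> U" using that W(3) by (auto intro: inv_into_into)
    show "smooth_in_chart (U, \<kappa>) (inv_into U \<kappa> y) f"
      using W that by (intro smooth_in_chartI[where W=W]) (auto simp: f_inv_into_f)
  qed
  then show ?thesis by (rule that[OF W])
qed

text \<open>Only the values over \<open>W\<close> are compared, so functions cut off outside a
  neighbourhood are covered.\<close>

lemma smooth_at_of_chart:
  assumes c: "(U, \<kappa>) \<in> A" "p \<in> U" and W: "open W" "\<kappa> p \<in> W" "W \<subseteq> \<kappa> ` U" "smooth_on W F"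
    and eq: "\<And>q. q \<in> U \<Longrightarrow> \<kappa> q \<in> W \<Longrightarrow> f q = F (\<kappa> q)"
  shows "smooth_at M p f"
proof (rule smooth_at_chartI[OF c], rule smooth_in_chartI[OF W(1)])
  have "F y = (f \<circ> inv_into U \<kappa>) y" if "y \<in> W" for y
  proof -
    have y: "y \<in> \<kappa> ` U" using that W(3) by blast
    show ?thesis using eq[OF inv_into_into[OF y]] that by (simp add: f_inv_into_f[OF y])
  qed
  then have "smooth_on W (f \<circ> inv_into U \<kappa>)"
    by (rule smooth_on_cong[OF W(1) _ W(4)])
  then show "smooth_on W (f \<circ> inv_into (fst (U, \<kappa>)) (snd (U, \<kappa>)))" by simp
qed (use W in auto)

lemma smooth_at_const: "smooth_at M p (\<lambda>q. r)"
proof -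
  obtain U \<kappa> where c: "(U, \<kappa>) \<in> A" "p \<in> U" by (rule obtain_chart)
  show ?thesis
    by (rule smooth_at_of_chart[OF c open_chart_image[OF c(1)] _ _ smooth_on_const])
      (use c open_chart_image[OF c(1)] in auto)
qed

lemma smooth_at_coordinate:
  assumes c: "(U, \<kappa>) \<in> A" "p \<in> U"
  shows "smooth_at M p (\<lambda>q. \<kappa> q $ k)"
  by (rule smooth_at_of_chart[OF c open_chart_image[OF c(1)] _ _ smooth_on_linear_map[OF _ bounded_linear_vec_nth]])
    (use c open_chart_image[OF c(1)] in auto)

lemma smooth_at_sum:
  "(\<And>i. i \<in> I \<Longrightarrow> smooth_at M p (f i)) \<Longrightarrow> smooth_at M p (\<lambda>q. \<Sum>i\<in>I. f i q)"
  by (induction I rule: infinite_finite_induct) (simp_all add: smooth_at_const smooth_at_add)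

text \<open>Leibniz applied to \<open>1 * 1 = 1\<close> gives \<open>D 1 = 2 * D 1\<close>;
  constants are multiples of 1.\<close>

lemma tangent_const:
  assumes "D \<in> tangent_space M p"
  shows "D (\<lambda>q. r) = 0"
  using tangent_spaceD(2)[OF assms smooth_at_const[of p 1] smooth_at_const[of p 1]]
    tangent_spaceD(3)[OF assms smooth_at_const[of p 1], of r] by simp

lemma tangent_sum:
  assumes "D \<in> tangent_space M p"
  shows "(\<And>i. i \<in> I \<Longrightarrow> smooth_at M p (f i)) \<Longrightarrow> D (\<lambda>q. \<Sum>i\<in>I. f i q) = (\<Sum>i\<in>I. D (f i))"
proof (induction I rule: infinite_finite_induct)
  case (insert i I)
  then show ?case
    using tangent_spaceD(1)[OF assms, of "f i" "\<lambda>q. \<Sum>i\<in>I. f i q"] by (simp add: smooth_at_sum)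
qed (simp_all add: tangent_const[OF assms])

text \<open>
  The indicator function of a neighbourhood is smooth at \<open>p\<close> in the sense of germs and idempotent,
  so derivations annihilate it.
\<close>

lemma tangent_local:
  assumes c: "(U, \<kappa>) \<in> A" "p \<in> U" and W: "open W" "\<kappa> p \<in> W"
    and D: "D \<in> tangent_space M p" and f: "smooth_at M p f" and g: "smooth_at M p g"
    and eq: "\<And>q. q \<in> U \<Longrightarrow> \<kappa> q \<in> W \<Longrightarrow> f q = g q"
  shows "D f = D g"
proof -
  define h where "h = (\<lambda>q. if q \<in> U \<and> \<kappa> q \<in> W then 1 else 0 :: real)"
  have o: "open (W \<inter> \<kappa> ` U)" using W open_chart_image[OF c(1)] by auto
  have h: "smooth_at M p h"
    by (rule smooth_at_of_chart[OF c o _ _ smooth_on_const[OF o, of 1]]) (use c W in \<open>auto simp: h_def\<close>)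
  have hp: "h p = 1" using c W by (simp add: h_def)
  have "(\<lambda>q. h q * h q) = h" by (auto simp: h_def)
  then have Dh: "D h = 0" using tangent_spaceD(2)[OF D h h] hp by simp
  have "(\<lambda>q. f q * h q) = (\<lambda>q. g q * h q)" using eq by (auto simp: h_def)
  then show ?thesis
    using tangent_spaceD(2)[OF D f h] tangent_spaceD(2)[OF D g h] by (simp add: hp Dh)
qed

section \<open>Coordinate vectors and components\<close>

lemma has_derivative_chart:
  assumes "(U, \<kappa>) \<in> A" "p \<in> U" "smooth_at M p f"
  shows "((f \<circ> inv_into U \<kappa>) has_derivative frechet_derivative (f \<circ> inv_into U \<kappa>) (at (\<kappa> p))) (at (\<kappa> p))"
  by (rule smooth_at_chartE[OF assms]) (rule smooth_on_has_derivative)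

lemma chart_vec_eq:
  assumes "smooth_at X p f" "((f \<circ> inv_into U \<kappa>) has_derivative F) (at (\<kappa> p))"
  shows "chart_vec X (U, \<kappa>) p w f = F w"
  using assms frechet_derivative_at[OF assms(2)] by (simp add: chart_vec_def)

lemma chart_vec_in_tangent_space:
  assumes c: "(U, \<kappa>) \<in> A" "p \<in> U"
  shows "chart_vec M (U, \<kappa>) p w \<in> tangent_space M p"
proof -
  let ?e = "inv_into U \<kappa>"
  have ep: "?e (\<kappa> p) = p" using inj_on_chart[OF c(1)] c(2) by simp
  have
    "chart_vec M (U, \<kappa>) p w (\<lambda>q. f q + g q) = chart_vec M (U, \<kappa>) p w f + chart_vec M (U, \<kappa>) p w g"
    "chart_vec M (U, \<kappa>) p w (\<lambda>q. f q * g q) = f p * chart_vec M (U, \<kappa>) p w g + g p * chart_vec M (U, \<kappa>) p w f"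
    if f: "smooth_at M p f" and g: "smooth_at M p g" for f g
  proof -
    note df = has_derivative_chart[OF c f] and dg = has_derivative_chart[OF c g]
    have "(((\<lambda>q. f q + g q) \<circ> ?e) has_derivative (\<lambda>v. frechet_derivative (f \<circ> ?e) (at (\<kappa> p)) v
        + frechet_derivative (g \<circ> ?e) (at (\<kappa> p)) v)) (at (\<kappa> p))"
      using has_derivative_add[OF df dg] by (simp add: o_def)
    from chart_vec_eq[OF smooth_at_add[OF f g] this]
    show "chart_vec M (U, \<kappa>) p w (\<lambda>q. f q + g q) = chart_vec M (U, \<kappa>) p w f + chart_vec M (U, \<kappa>) p w g"
      by (simp add: chart_vec_eq[OF f df] chart_vec_eq[OF g dg])
    have "(((\<lambda>q. f q * g q) \<circ> ?e) has_derivative (\<lambda>v. f p * frechet_derivative (g \<circ> ?e) (at (\<kappa> p)) v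
        + frechet_derivative (f \<circ> ?e) (at (\<kappa> p)) v * g p)) (at (\<kappa> p))"
      using has_derivative_mult[OF df dg] by (simp add: o_def ep)
    from chart_vec_eq[OF smooth_at_mult[OF f g] this]
    show "chart_vec M (U, \<kappa>) p w (\<lambda>q. f q * g q) = f p * chart_vec M (U, \<kappa>) p w g + g p * chart_vec M (U, \<kappa>) p w f"
      by (simp add: chart_vec_eq[OF f df] chart_vec_eq[OF g dg] mult.commute)
  qed
  moreover have "chart_vec M (U, \<kappa>) p w (\<lambda>q. r * f q) = r * chart_vec M (U, \<kappa>) p w f"
    if f: "smooth_at M p f" for r f
  proof -
    note df = has_derivative_chart[OF c f]
    have "(((\<lambda>q. r * f q) \<circ> ?e) has_derivative (\<lambda>v. r * frechet_derivative (f \<circ> ?e) (at (\<kappa> p)) v)) (at (\<kappa> p))"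
      using has_derivative_mult_right[OF df, of r] by (simp add: o_def)
    from chart_vec_eq[OF smooth_at_cmult[OF f] this] show ?thesis
      by (simp add: chart_vec_eq[OF f df])
  qed
  moreover have "chart_vec M (U, \<kappa>) p w f = 0" if "\<not> smooth_at M p f" for f
    using that by (simp add: chart_vec_def)
  ultimately show ?thesis by (simp add: tangent_space_def)
qed

lemma components_chart_vec:
  assumes c: "(U, \<kappa>) \<in> A" "p \<in> U"
  shows "components (U, \<kappa>) (chart_vec M (U, \<kappa>) p w) = w"
proof -
  have "chart_vec M (U, \<kappa>) p w (\<lambda>q. \<kappa> q $ k) = w $ k" for k
  proof (rule chart_vec_eq[OF smooth_at_coordinate[OF c]])
    show "(((\<lambda>q. \<kappa> q $ k) \<circ> inv_into U \<kappa>) has_derivative (\<lambda>w. w $ k)) (at (\<kappa> p))"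
      by (rule has_derivative_transform_within_open[OF
            bounded_linear_imp_has_derivative[OF bounded_linear_vec_nth] open_chart_image[OF c(1)]])
        (use c in \<open>auto simp: f_inv_into_f\<close>)
  qed
  then show ?thesis by (simp add: components_def vec_eq_iff)
qed

lemma components_add: "components c (D + E) = components c D + components c E"
  by (simp add: components_def vec_eq_iff split_beta)

lemma components_scale: "components c (r *\<^sub>T D) = r *\<^sub>R components c D"
  by (simp add: components_def vec_eq_iff split_beta)

text \<open>Hadamard's lemma writes a function near \<open>p\<close> as a combination of coordinate functions.\<close>

lemma chart_vec_components:
  assumes c: "(U, \<kappa>) \<in> A" "p \<in> U" and D: "D \<in> tangent_space M p"
  shows "chart_vec M (U, \<kappa>) p (components (U, \<kappa>) D) = D"
proof
  fix f
  show "chart_vec M (U, \<kappa>) p (components (U, \<kappa>) D) f = D f"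
  proof (cases "smooth_at M p f")
    case False
    then show ?thesis using tangent_spaceD(4)[OF D] by (simp add: chart_vec_def)
  next
    case True
    let ?F = "f \<circ> inv_into U \<kappa>" and ?p = "\<kappa> p"
    obtain W where W: "open W" "?p \<in> W" "W \<subseteq> \<kappa> ` U" "smooth_on W ?F"
      by (rule smooth_at_chartE[OF c True]) (rule that)
    \<comment> \<open>Hadamard's lemma needs a convex domain, so \<open>W\<close> is shrunk to a
      ball.\<close>
    obtain e where e: "e > 0" "ball ?p e \<subseteq> W" using W openE by blast
    let ?B = "ball ?p e"
    have B: "open ?B" "?p \<in> ?B" "?B \<subseteq> \<kappa> ` U" using e W by auto
    obtain H where H: "\<And>b. smooth_on ?B (H b)" "\<And>b. H b ?p = frechet_derivative ?F (at ?p) b"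
      "\<And>x. x \<in> ?B \<Longrightarrow> ?F x = ?F ?p + (\<Sum>b\<in>Basis. ((x - ?p) \<bullet> b) * H b x)"
      using smooth_on_hadamard[OF _ _ _ smooth_on_subset[OF W(4) e(2)], of ?p] B by auto
    have inv: "inv_into U \<kappa> (\<kappa> q) = q" if "q \<in> U" for q
      using inj_on_chart[OF c(1)] that by simp
    \<comment> \<open>The summands of Hadamard's expansion. The first factor vanishes at
      \<open>p\<close>, so the Leibniz rule leaves only its derivative, a component of
      \<open>D\<close>, times the value of \<open>H\<close> at \<open>p\<close>.\<close>
    define K where "K k q = (\<kappa> q $ k + (- (?p $ k))) * H (axis k 1) (\<kappa> q)" for k q
    have sH: "smooth_at M p (\<lambda>q. H b (\<kappa> q))" for b
      by (rule smooth_at_of_chart[OF c B H(1)]) simp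
    have sc: "smooth_at M p (\<lambda>q. \<kappa> q $ k + (- (?p $ k)))" for k
      by (rule smooth_at_add[OF smooth_at_coordinate[OF c] smooth_at_const])
    have sK: "smooth_at M p (K k)" for k
      unfolding K_def by (rule smooth_at_mult[OF sc sH])
    have basis: "(\<Sum>b\<in>Basis. (v \<bullet> b) * G b) = (\<Sum>k\<in>UNIV. v $ k * G (axis k 1))" for v :: "real ^ 'n" and G
      by (simp add: Basis_vec_def sum.UNION_disjoint axis_eq_axis inner_axis UNION_singleton_eq_range sum.reindex inj_on_def)
    have eq: "f q = f p + (\<Sum>k\<in>UNIV. K k q)" if "q \<in> U" "\<kappa> q \<in> ?B" for q
      using H(3)[OF that(2)] basis[of "\<kappa> q - ?p" "\<lambda>b. H b (\<kappa> q)"] inv[OF that(1)] inv[OF c(2)]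
      by (simp add: K_def)
    have "D f = D (\<lambda>q. f p + (\<Sum>k\<in>UNIV. K k q))"
      by (rule tangent_local[OF c B(1,2) D True]) (use eq in \<open>auto intro!: smooth_at_add smooth_at_const smooth_at_sum sK\<close>)
    also have "\<dots> = (\<Sum>k\<in>UNIV. D (K k))"
      using tangent_spaceD(1)[OF D smooth_at_const[of p "f p"] smooth_at_sum[where I=UNIV and f=K, OF sK]]
      by (simp add: tangent_const[OF D] tangent_sum[OF D sK])
    also have "\<dots> = (\<Sum>k\<in>UNIV. components (U, \<kappa>) D $ k * H (axis k 1) ?p)"
    proof (rule sum.cong[OF refl])
      fix k :: 'n
      have "D (\<lambda>q. \<kappa> q $ k + (- (?p $ k))) = components (U, \<kappa>) D $ k"
        using tangent_spaceD(1)[OF D smooth_at_coordinate[OF c, of k] smooth_at_const[of p "- (?p $ k)"]]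
        by (simp only: tangent_const[OF D] components_def prod.case) simp
      then show "D (K k) = components (U, \<kappa>) D $ k * H (axis k 1) ?p"
        using tangent_spaceD(2)[OF D sc[of k] sH[of "axis k 1"]]
        unfolding K_def by simp
    qed
    also have "\<dots> = (\<Sum>b\<in>Basis. (components (U, \<kappa>) D \<bullet> b) * frechet_derivative ?F (at ?p) b)"
      using basis[of "components (U, \<kappa>) D" "\<lambda>b. frechet_derivative ?F (at ?p) b"] by (simp add: H(2))
    also have "\<dots> = frechet_derivative ?F (at ?p) (components (U, \<kappa>) D)"
    proof -
      have l: "linear (frechet_derivative ?F (at ?p))"
        using has_derivative_chart[OF c True] by (rule has_derivative_linear)
      show ?thesis
        using arg_cong[OF euclidean_representation[of "components (U, \<kappa>) D"], of "frechet_derivative ?F (at ?p)"]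
        by (simp add: linear_sum[OF l] linear_scale[OF l] del: euclidean_representation)
    qed
    finally show ?thesis using True by (simp add: chart_vec_def)
  qed
qed

end

lemma linear_sum_axis:
  fixes L :: "real ^ 'n::finite \<Rightarrow> real"
  assumes "linear L"
  shows "L w = (\<Sum>i\<in>UNIV. w $ i * L (axis i 1))"
proof -
  have "L w = L (\<Sum>i\<in>UNIV. w $ i *s axis i 1)" by (simp add: basis_expansion)
  also have "\<dots> = (\<Sum>i\<in>UNIV. w $ i * L (axis i 1))"
    by (simp add: linear_sum[OF assms] linear_scale[OF assms] scalar_mult_eq_scaleR)
  finally show ?thesis .
qed

section \<open>Algebra of smooth functions on an embedded submanifold\<close>

lemma smooth_at_submanifold_add:
  assumes "smooth_at (submanifold_space (manifold_space A) S) p f"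
    "smooth_at (submanifold_space (manifold_space A) S) p h"
  shows "smooth_at (submanifold_space (manifold_space A) S) p (\<lambda>q. f q + h q)"
proof -
  obtain F H where "smooth_at (manifold_space A) p F" "\<forall>q\<in>S. f q = F q"
    "smooth_at (manifold_space A) p H" "\<forall>q\<in>S. h q = H q"
    using assms by (auto simp: submanifold_space_def)
  then show ?thesis
    by (auto simp: submanifold_space_def intro!: exI[of _ "\<lambda>q. F q + H q"] smooth_at_add)
qed

lemma smooth_at_submanifold_mult:
  assumes "smooth_at (submanifold_space (manifold_space A) S) p f"
    "smooth_at (submanifold_space (manifold_space A) S) p h"
  shows "smooth_at (submanifold_space (manifold_space A) S) p (\<lambda>q. f q * h q)"
proof -
  obtain F H where "smooth_at (manifold_space A) p F" "\<forall>q\<in>S. f q = F q"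
    "smooth_at (manifold_space A) p H" "\<forall>q\<in>S. h q = H q"
    using assms by (auto simp: submanifold_space_def)
  then show ?thesis
    by (auto simp: submanifold_space_def intro!: exI[of _ "\<lambda>q. F q * H q"] smooth_at_mult)
qed

lemma smooth_at_submanifold_cmult:
  assumes "smooth_at (submanifold_space (manifold_space A) S) p f"
  shows "smooth_at (submanifold_space (manifold_space A) S) p (\<lambda>q. r * f q)"
proof -
  obtain F where "smooth_at (manifold_space A) p F" "\<forall>q\<in>S. f q = F q"
    using assms by (auto simp: submanifold_space_def)
  then show ?thesis
    by (auto simp: submanifold_space_def intro!: exI[of _ "\<lambda>q. r * F q"] smooth_at_cmult)
qed

context smooth_atlas
begin

lemma chart_vec_add:
  assumes c: "(U, \<kappa>) \<in> A" "p \<in> U"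
  shows "chart_vec M (U, \<kappa>) p (v + w) = chart_vec M (U, \<kappa>) p v + chart_vec M (U, \<kappa>) p w"
proof
  fix f
  show "chart_vec M (U, \<kappa>) p (v + w) f = (chart_vec M (U, \<kappa>) p v + chart_vec M (U, \<kappa>) p w) f"
    using has_derivative_linear[OF has_derivative_chart[OF c, of f]]
    by (simp add: chart_vec_def linear_add)
qed

lemma chart_vec_scale:
  assumes c: "(U, \<kappa>) \<in> A" "p \<in> U"
  shows "chart_vec M (U, \<kappa>) p (r *\<^sub>R w) = r *\<^sub>T chart_vec M (U, \<kappa>) p w"
proof
  fix f
  show "chart_vec M (U, \<kappa>) p (r *\<^sub>R w) f = (r *\<^sub>T chart_vec M (U, \<kappa>) p w) f"
    using has_derivative_linear[OF has_derivative_chart[OF c, of f]]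
    by (simp add: chart_vec_def linear_scale)
qed

lemma field_smooth_at_coordinate_field:
  assumes c: "(U, \<kappa>) \<in> A" "p \<in> U"
  shows "field_smooth_at M p (coordinate_field A (U, \<kappa>) i)"
  unfolding field_smooth_at_def
proof (intro conjI ballI allI impI)
  fix q
  show "coordinate_field A (U, \<kappa>) i q \<in> tangent_space M q"
    using chart_vec_in_tangent_space[OF c(1), of q]
    by (simp add: coordinate_field_def tangent_space_zero)
next
  fix f assume f: "smooth_at M p f"
  obtain W where W: "open W" "\<kappa> p \<in> W" "W \<subseteq> \<kappa> ` U" "smooth_on W (f \<circ> inv_into U \<kappa>)"
    and sm: "\<And>y. y \<in> W \<Longrightarrow> smooth_at M (inv_into U \<kappa> y) f"
    by (rule smooth_at_chartE[OF c f]) (rule that)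
  show "smooth_at M p (\<lambda>q. coordinate_field A (U, \<kappa>) i q f)"
  proof (rule smooth_at_of_chart[OF c W(1,2,3) smooth_on_frechet_derivative[OF W(4)]])
    fix q assume q: "q \<in> U" "\<kappa> q \<in> W"
    \<comment> \<open>\<open>chart_vec\<close> has the default value 0 on functions that are not
      smooth at its base point, so reading it as a partial derivative requires \<open>f\<close> to
      be smooth at \<open>q\<close> and not merely at \<open>p\<close>.\<close>
    have "smooth_at M q f" using sm[OF q(2)] inj_on_chart[OF c(1)] q(1) by simp
    then show "coordinate_field A (U, \<kappa>) i q f =
        frechet_derivative (f \<circ> inv_into U \<kappa>) (at (\<kappa> q)) (axis i 1)"
      using q(1) by (simp add: coordinate_field_def chart_vec_def)
  qed
qed

section \<open>Charts of the tangent bundle\<close>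

abbreviation TM :: "('m \<times> 'm tvec) smooth_space" where "TM \<equiv> tangent_bundle A"

abbreviation tchart_inv :: "'m set \<Rightarrow> ('m \<Rightarrow> real ^ 'n) \<Rightarrow> (real ^ 'n) \<times> (real ^ 'n) \<Rightarrow> 'm \<times> 'm tvec" where
  "tchart_inv U \<kappa> z \<equiv> (inv_into U \<kappa> (fst z), chart_vec M (U, \<kappa>) (inv_into U \<kappa> (fst z)) (snd z))"

lemma tangent_chart_sel:
  "(x, u) \<in> fst (tangent_chart A (U, \<kappa>)) \<longleftrightarrow> x \<in> U \<and> u \<in> tangent_space M x"
  "snd (tangent_chart A (U, \<kappa>)) (x, u) = (\<kappa> x, components (U, \<kappa>) u)"
  by (simp_all add: tangent_chart_def)

text \<open>Injectivity of the tangent chart is where \<open>chart_vec_components\<close> enters: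
  derivations with equal components are both rebuilt from them.\<close>

lemma inv_into_tangent_chart:
  assumes c: "(U, \<kappa>) \<in> A" and y: "fst z \<in> \<kappa> ` U"
  shows "inv_into (fst (tangent_chart A (U, \<kappa>))) (snd (tangent_chart A (U, \<kappa>))) z = tchart_inv U \<kappa> z"
proof (rule inv_into_f_eq)
  show "inj_on (snd (tangent_chart A (U, \<kappa>))) (fst (tangent_chart A (U, \<kappa>)))"
  proof (rule inj_onI, clarify)
    fix x u x' u'
    assume "(x, u) \<in> fst (tangent_chart A (U, \<kappa>))" "(x', u') \<in> fst (tangent_chart A (U, \<kappa>))"
      "snd (tangent_chart A (U, \<kappa>)) (x, u) = snd (tangent_chart A (U, \<kappa>)) (x', u')"
    then have *: "x \<in> U" "u \<in> tangent_space M x" "x' \<in> U" "u' \<in> tangent_space M x'"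
      "\<kappa> x = \<kappa> x'" "components (U, \<kappa>) u = components (U, \<kappa>) u'"
      by (simp_all add: tangent_chart_sel)
    have x: "x = x'" by (rule inj_onD[OF inj_on_chart[OF c] *(5,1,3)])
    have "u = chart_vec M (U, \<kappa>) x (components (U, \<kappa>) u)"
      by (rule chart_vec_components[OF c *(1,2), symmetric])
    also have "\<dots> = u'"
      unfolding *(6) x by (rule chart_vec_components[OF c *(3,4)])
    finally show "x = x' \<and> u = u'" using x by (intro conjI)
  qed
  have U: "inv_into U \<kappa> (fst z) \<in> U" using y by (rule inv_into_into)
  show "tchart_inv U \<kappa> z \<in> fst (tangent_chart A (U, \<kappa>))"
    by (simp add: tangent_chart_sel U chart_vec_in_tangent_space[OF c U])
  show "snd (tangent_chart A (U, \<kappa>)) (tchart_inv U \<kappa> z) = z"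
    by (simp add: tangent_chart_sel components_chart_vec[OF c U] f_inv_into_f[OF y])
qed

lemma tchart_inv_chart:
  assumes "(U, \<kappa>) \<in> A" "x \<in> U" "u \<in> tangent_space M x"
  shows "tchart_inv U \<kappa> (\<kappa> x, components (U, \<kappa>) u) = (x, u)"
  using inj_on_chart[OF assms(1)] assms(2) by (simp add: chart_vec_components[OF assms])

lemma tangent_chart_image:
  assumes c: "(U, \<kappa>) \<in> A"
  shows "snd (tangent_chart A (U, \<kappa>)) ` fst (tangent_chart A (U, \<kappa>)) = \<kappa> ` U \<times> UNIV"
proof
  show "snd (tangent_chart A (U, \<kappa>)) ` fst (tangent_chart A (U, \<kappa>)) \<subseteq> \<kappa> ` U \<times> UNIV"
    by (auto simp: tangent_chart_def)
  show "\<kappa> ` U \<times> UNIV \<subseteq> snd (tangent_chart A (U, \<kappa>)) ` fst (tangent_chart A (U, \<kappa>))"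
  proof clarify
    fix x w assume x: "x \<in> U"
    have "(x, chart_vec M (U, \<kappa>) x w) \<in> fst (tangent_chart A (U, \<kappa>))"
      "snd (tangent_chart A (U, \<kappa>)) (x, chart_vec M (U, \<kappa>) x w) = (\<kappa> x, w)"
      by (simp_all add: tangent_chart_sel x chart_vec_in_tangent_space[OF c x] components_chart_vec[OF c x])
    then show "(\<kappa> x, w) \<in> snd (tangent_chart A (U, \<kappa>)) ` fst (tangent_chart A (U, \<kappa>))"
      by (metis imageI)
  qed
qed

lemma smooth_at_tangent_bundleE:
  assumes c: "(U, \<kappa>) \<in> A" "x \<in> U" "u \<in> tangent_space M x" and f: "smooth_at TM (x, u) f"
  obtains W where "open W" "(\<kappa> x, components (U, \<kappa>) u) \<in> W" "W \<subseteq> \<kappa> ` U \<times> UNIV"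
    "smooth_on W (\<lambda>z. f (tchart_inv U \<kappa> z))"
proof -
  have "smooth_in_chart (tangent_chart A (U, \<kappa>)) (x, u) f"
    using f c unfolding tangent_bundle_def smooth_at_manifold_space by (simp add: tangent_chart_sel)
  then obtain W where W': "open W" "snd (tangent_chart A (U, \<kappa>)) (x, u) \<in> W"
    "W \<subseteq> snd (tangent_chart A (U, \<kappa>)) ` fst (tangent_chart A (U, \<kappa>))"
    "smooth_on W (f \<circ> inv_into (fst (tangent_chart A (U, \<kappa>))) (snd (tangent_chart A (U, \<kappa>))))"
    by (rule smooth_in_chartE)
  note W = W'[unfolded tangent_chart_image[OF c(1)] tangent_chart_sel(2)]
  have "smooth_on W (\<lambda>z. f (tchart_inv U \<kappa> z))"
  proof (rule smooth_on_cong[OF W(1) _ W(4)])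
    fix z assume "z \<in> W"
    then have "fst z \<in> \<kappa> ` U" using W(3) by auto
    from inv_into_tangent_chart[OF c(1) this]
    show "(f \<circ> inv_into (fst (tangent_chart A (U, \<kappa>))) (snd (tangent_chart A (U, \<kappa>)))) z = f (tchart_inv U \<kappa> z)"
      by simp
  qed
  then show ?thesis by (rule that[OF W(1,2,3)])
qed

lemma smooth_at_tangent_bundleI:
  assumes "\<And>U \<kappa>. (U, \<kappa>) \<in> A \<Longrightarrow> x \<in> U \<Longrightarrow> u \<in> tangent_space M x \<Longrightarrow>
    \<exists>W. open W \<and> (\<kappa> x, components (U, \<kappa>) u) \<in> W \<and> W \<subseteq> \<kappa> ` U \<times> UNIV \<and>
      smooth_on W (\<lambda>z. f (tchart_inv U \<kappa> z))"
  shows "smooth_at TM (x, u) f"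
  unfolding tangent_bundle_def smooth_at_manifold_space
proof (intro ballI impI)
  fix tc assume "tc \<in> tangent_chart A ` A" and xu: "(x, u) \<in> fst tc"
  then obtain U \<kappa> where c: "(U, \<kappa>) \<in> A" and tc: "tc = tangent_chart A (U, \<kappa>)" by auto
  have x: "x \<in> U" "u \<in> tangent_space M x" using xu by (simp_all add: tc tangent_chart_sel)
  obtain W where W: "open W" "(\<kappa> x, components (U, \<kappa>) u) \<in> W" "W \<subseteq> \<kappa> ` U \<times> UNIV"
    "smooth_on W (\<lambda>z. f (tchart_inv U \<kappa> z))"
    using assms[OF c x] by (elim exE conjE)
  have "smooth_on W (f \<circ> inv_into (fst tc) (snd tc))"
  proof (rule smooth_on_cong[OF W(1) _ W(4)])
    fix z assume "z \<in> W"
    then have "fst z \<in> \<kappa> ` U" using W(3) by auto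
    from inv_into_tangent_chart[OF c this]
    show "f (tchart_inv U \<kappa> z) = (f \<circ> inv_into (fst tc) (snd tc)) z"
      by (simp add: tc)
  qed
  then show "smooth_in_chart tc (x, u) f"
    using W by (intro smooth_in_chartI[where W=W]) (simp_all add: tc tangent_chart_image[OF c] tangent_chart_sel(2))
qed

text \<open>In a tangent chart the line is affine in \<open>s\<close>, so the chain rule applies.
  Hence the \<open>deriv\<close> in the vertical lift is a true derivative and not an arbitrary
  choice.\<close>

lemma fiber_line_differentiable:
  assumes u: "u \<in> tangent_space M x" and X: "X \<in> tangent_space M x" and F: "smooth_at TM (x, u) F"
  shows "((\<lambda>s. F (x, u + s *\<^sub>T X)) has_real_derivative deriv (\<lambda>s. F (x, u + s *\<^sub>T X)) 0) (at 0)"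
proof -
  obtain U \<kappa> where c: "(U, \<kappa>) \<in> A" "x \<in> U" by (rule obtain_chart)
  obtain W where W: "open W" "(\<kappa> x, components (U, \<kappa>) u) \<in> W" "smooth_on W (\<lambda>z. F (tchart_inv U \<kappa> z))"
    by (rule smooth_at_tangent_bundleE[OF c u F]) (rule that)
  define l where "l s = (\<kappa> x, components (U, \<kappa>) u + s *\<^sub>R components (U, \<kappa>) X)" for s :: real
  have eq: "F (x, u + s *\<^sub>T X) = F (tchart_inv U \<kappa> (l s))" for s
    using tchart_inv_chart[OF c tangent_space_add[OF u tangent_space_scale[OF X, of s]]]
    by (simp only: l_def components_add components_scale)
  have l0: "l 0 = (\<kappa> x, components (U, \<kappa>) u)" by (simp add: l_def)
  have dl: "(l has_derivative (\<lambda>s. (0, s *\<^sub>R components (U, \<kappa>) X))) (at 0)"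
    unfolding l_def by (auto intro!: derivative_eq_intros)
  have "(\<lambda>s. F (tchart_inv U \<kappa> (l s))) differentiable (at 0)"
    by (rule differentiableI[OF has_derivative_compose[OF dl smooth_on_has_derivative[OF W(3,2), folded l0]]])
  then have "(\<lambda>s. F (x, u + s *\<^sub>T X)) differentiable (at 0)" by (simp only: eq)
  then show ?thesis
    by (simp only: DERIV_deriv_iff_real_differentiable)
qed

end

section \<open>The unit tangent bundle\<close>

locale riemannian_atlas = smooth_atlas A
  for A :: "('m::{t2_space,second_countable_topology}, real ^ 'n::finite) chart set" +
  fixes g :: "'m bilin"
  assumes riemannian: "riemannian_metric (manifold_space A) g"
begin

abbreviation SM :: "('m \<times> 'm tvec) smooth_space" where "SM \<equiv> unit_tangent_bundle A g"

lemma metric: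
  shows metric_sym: "D \<in> tangent_space M x \<Longrightarrow> E \<in> tangent_space M x \<Longrightarrow> g x D E = g x E D"
    and metric_add: "D \<in> tangent_space M x \<Longrightarrow> E \<in> tangent_space M x \<Longrightarrow> F \<in> tangent_space M x \<Longrightarrow>
      g x (D + E) F = g x D F + g x E F"
    and metric_scale: "D \<in> tangent_space M x \<Longrightarrow> E \<in> tangent_space M x \<Longrightarrow> g x (r *\<^sub>T D) E = r * g x D E"
    and metric_smooth: "field_smooth_at M x V \<Longrightarrow> field_smooth_at M x W \<Longrightarrow>
      smooth_at M x (\<lambda>q. g q (V q) (W q))"
  using riemannian by (simp_all add: riemannian_metric_def symmetric_tensor_def)

lemma metric_scale_right:
  "D \<in> tangent_space M x \<Longrightarrow> E \<in> tangent_space M x \<Longrightarrow> g x E (r *\<^sub>T D) = r * g x E D"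
  using metric_scale[of D x E r] by (simp add: metric_sym[of E x] tangent_space_scale)

lemma pts_SM: "(x, u) \<in> pts SM \<longleftrightarrow> u \<in> tangent_space M x \<and> g x u u = 1"
  by (simp add: unit_tangent_bundle_def submanifold_space_def)

text \<open>Smoothness of \<open>g\<close> is known only for fields on the base. The expansion
  separates the base point, in the Gram matrix of the coordinate vectors, from the fibre
  coordinates.\<close>

lemma metric_gram:
  assumes c: "(U, \<kappa>) \<in> A" "x \<in> U"
  shows "g x (chart_vec M (U, \<kappa>) x v) (chart_vec M (U, \<kappa>) x w) =
    (\<Sum>i\<in>UNIV. \<Sum>j\<in>UNIV. (v $ i * w $ j) *
      g x (chart_vec M (U, \<kappa>) x (axis i 1)) (chart_vec M (U, \<kappa>) x (axis j 1)))"
proof -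
  let ?e = "chart_vec M (U, \<kappa>) x"
  note T = chart_vec_in_tangent_space[OF c]
  have lin: "linear (\<lambda>v. g x (?e v) (?e w))" for w
    by (rule linearI) (simp_all add: chart_vec_add[OF c] chart_vec_scale[OF c] metric_add metric_scale T)
  have "g x (?e (axis i 1)) (?e w) = (\<Sum>j\<in>UNIV. w $ j * g x (?e (axis i 1)) (?e (axis j 1)))" for i
    using linear_sum_axis[OF lin, of w "axis i 1"] unfolding metric_sym[OF T T, of _ "axis i 1"] .
  then show ?thesis
    using linear_sum_axis[OF lin, of v w] by (simp add: sum_distrib_left mult.assoc)
qed

text \<open>In a tangent chart the squared length is a quadratic polynomial in the fibre coordinates
  whose coefficients, \<open>g\<close> on pairs of coordinate fields, are smooth on the
  base.\<close>

lemma smooth_squared_length: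
  assumes c: "(U, \<kappa>) \<in> A" "x \<in> U"
  obtains V where "open V" "\<kappa> x \<in> V" "V \<subseteq> \<kappa> ` U"
    "smooth_on (V \<times> UNIV) (\<lambda>z. g (inv_into U \<kappa> (fst z)) (chart_vec M (U, \<kappa>) (inv_into U \<kappa> (fst z)) (snd z))
      (chart_vec M (U, \<kappa>) (inv_into U \<kappa> (fst z)) (snd z)))"
proof -
  define G where "G ij y = g (inv_into U \<kappa> y) (chart_vec M (U, \<kappa>) (inv_into U \<kappa> y) (axis (fst ij) 1))
    (chart_vec M (U, \<kappa>) (inv_into U \<kappa> y) (axis (snd ij) 1))" for ij y
  have "\<exists>V. open V \<and> \<kappa> x \<in> V \<and> V \<subseteq> \<kappa> ` U \<and> smooth_on V (G ij)" for ij
  proof -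
    define f where "f q = g q (coordinate_field A (U, \<kappa>) (fst ij) q) (coordinate_field A (U, \<kappa>) (snd ij) q)" for q
    have f: "smooth_at M x f"
      unfolding f_def by (intro metric_smooth field_smooth_at_coordinate_field c)
    obtain V where V: "open V" "\<kappa> x \<in> V" "V \<subseteq> \<kappa> ` U" "smooth_on V (f \<circ> inv_into U \<kappa>)"
      by (rule smooth_at_chartE[OF c f]) (rule that)
    have "smooth_on V (G ij)"
    proof (rule smooth_on_cong[OF V(1) _ V(4)])
      fix y assume "y \<in> V"
      then have "inv_into U \<kappa> y \<in> U" using V(3) by (auto intro: inv_into_into)
      then show "(f \<circ> inv_into U \<kappa>) y = G ij y"
        by (simp add: f_def G_def coordinate_field_def)
    qed
    with V show ?thesis by (intro exI[of _ V] conjI)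
  qed
  then have "\<forall>ij. \<exists>V. open V \<and> \<kappa> x \<in> V \<and> V \<subseteq> \<kappa> ` U \<and> smooth_on V (G ij)" by (rule allI)
  from choice[OF this] obtain V where
    V0: "\<forall>ij. open (V ij) \<and> \<kappa> x \<in> V ij \<and> V ij \<subseteq> \<kappa> ` U \<and> smooth_on (V ij) (G ij)" ..
  have V: "open (V ij)" "\<kappa> x \<in> V ij" "V ij \<subseteq> \<kappa> ` U" "smooth_on (V ij) (G ij)" for ij
    using spec[OF V0, of ij] by simp_all
  \<comment> \<open>Each Gram entry comes with its own neighbourhood; there are finitely many index
    pairs, so the intersection is open.\<close>
  define V' where "V' = (\<Inter>ij. V ij)"
  have V': "open V'" "\<kappa> x \<in> V'"
    unfolding V'_def using V(1,2) by (auto intro!: open_INT)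
  have V'3: "V' \<subseteq> \<kappa> ` U"
    unfolding V'_def by (rule INF_lower2[OF UNIV_I]) (rule V(3))
  have o: "open (V' \<times> (UNIV :: (real ^ 'n) set))" using V'(1) by (intro open_Times open_UNIV)
  have s: "smooth_on (V' \<times> UNIV) (\<lambda>z::(real ^ 'n) \<times> (real ^ 'n). snd z $ i)" for i
    by (rule smooth_on_linear_map[OF o bounded_linear_compose[OF bounded_linear_vec_nth bounded_linear_snd]])
  have "smooth_on (V' \<times> UNIV) (\<lambda>z. \<Sum>i\<in>UNIV. \<Sum>j\<in>UNIV. (snd z $ i * snd z $ j) * G (i, j) (fst z))"
  proof (intro smooth_on_sum[OF o] smooth_on_bilinear[OF o bounded_bilinear_mult] s)
    fix i j :: 'n
    show "smooth_on (V' \<times> UNIV) (\<lambda>z::(real ^ 'n) \<times> (real ^ 'n). G (i, j) (fst z))"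
      by (rule smooth_on_compose[OF o _ smooth_on_linear_map[OF o bounded_linear_fst] V(4)])
        (auto simp: V'_def)
  qed
  then have "smooth_on (V' \<times> UNIV) (\<lambda>z. g (inv_into U \<kappa> (fst z)) (chart_vec M (U, \<kappa>) (inv_into U \<kappa> (fst z)) (snd z))
      (chart_vec M (U, \<kappa>) (inv_into U \<kappa> (fst z)) (snd z)))"
  proof (rule smooth_on_cong[OF o, rotated])
    fix z :: "(real ^ 'n) \<times> (real ^ 'n)" assume "z \<in> V' \<times> UNIV"
    then have "fst z \<in> \<kappa> ` U" using V'3 by auto
    from metric_gram[OF c(1) inv_into_into[OF this], of "snd z" "snd z"]
    show "(\<Sum>i\<in>UNIV. \<Sum>j\<in>UNIV. (snd z $ i * snd z $ j) * G (i, j) (fst z)) =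
       g (inv_into U \<kappa> (fst z)) (chart_vec M (U, \<kappa>) (inv_into U \<kappa> (fst z)) (snd z))
      (chart_vec M (U, \<kappa>) (inv_into U \<kappa> (fst z)) (snd z))"
      by (simp add: G_def)
  qed
  then show ?thesis by (rule that[OF V' V'3])
qed

text \<open>\<open>f\<close> agrees on the unit tangent bundle with a smooth \<open>F\<close>, and
  normalisation lands there, so \<open>F\<close> may replace \<open>f\<close>. In coordinates
  normalisation divides the fibre part by the root of the squared length, which is smooth where that
  length is positive.\<close>

lemma smooth_at_unit_normalize:
  assumes p: "(x, u) \<in> pts SM" and f: "smooth_at SM (x, u) f"
  shows "smooth_at TM (x, u) (f \<circ> unit_normalize g)"
proof (rule smooth_at_tangent_bundleI)
  fix U \<kappa> assume c: "(U, \<kappa>) \<in> A" "x \<in> U" and u: "u \<in> tangent_space M x"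
  have gu: "g x u u = 1" using p by (simp add: pts_SM)
  obtain F where F: "smooth_at TM (x, u) F" and fF: "\<And>q. q \<in> pts SM \<Longrightarrow> f q = F q"
    using f unfolding unit_tangent_bundle_def submanifold_space_def by auto
  obtain W where W: "open W" "(\<kappa> x, components (U, \<kappa>) u) \<in> W" "W \<subseteq> \<kappa> ` U \<times> UNIV"
    "smooth_on W (\<lambda>z. F (tchart_inv U \<kappa> z))"
    by (rule smooth_at_tangent_bundleE[OF c u F])
  define Q where "Q z = g (inv_into U \<kappa> (fst z)) (chart_vec M (U, \<kappa>) (inv_into U \<kappa> (fst z)) (snd z))
      (chart_vec M (U, \<kappa>) (inv_into U \<kappa> (fst z)) (snd z))" for z
  obtain V where V: "open V" "\<kappa> x \<in> V" "V \<subseteq> \<kappa> ` U" "smooth_on (V \<times> UNIV) Q"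
    unfolding Q_def by (rule smooth_squared_length[OF c])
  have oV: "open (V \<times> (UNIV :: (real ^ 'n) set))" using V(1) by (intro open_Times open_UNIV)
  define h where "h z = (fst z, (1 / sqrt (Q z)) *\<^sub>R snd z)" for z :: "(real ^ 'n) \<times> (real ^ 'n)"
  \<comment> \<open>First the region where the root may be inverted; \<open>W'\<close> below then
    shrinks it to points whose normalisation stays in the domain \<open>W\<close> of the
    extension.\<close>
  define W1 where "W1 = {z \<in> V \<times> UNIV. Q z \<in> {0<..}}"
  have o1: "open W1"
    unfolding W1_def by (rule open_preimage_Int[OF oV smooth_on_continuous[OF V(4)] open_greaterThan])
  have Q1: "smooth_on W1 Q" by (rule smooth_on_subset[OF V(4)]) (auto simp: W1_def)
  have h1: "smooth_on W1 h"
    unfolding h_def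
    by (intro smooth_on_Pair[OF o1] smooth_on_linear_map[OF o1] bounded_linear_fst bounded_linear_snd
        smooth_on_bilinear[OF o1 bounded_bilinear_scaleR] smooth_on_compose[OF o1 _ Q1 smooth_on_inverse_sqrt])
      (auto simp: W1_def)
  define W' where "W' = {z \<in> W1. h z \<in> W}"
  have o': "open W'"
    unfolding W'_def by (rule open_preimage_Int[OF o1 smooth_on_continuous[OF h1] W(1)])
  have sub: "W' \<subseteq> \<kappa> ` U \<times> UNIV" using V(3) by (auto simp: W'_def W1_def)
  have Qp: "Q (\<kappa> x, components (U, \<kappa>) u) = 1"
    using inj_on_chart[OF c(1)] c(2) by (simp add: Q_def chart_vec_components[OF c u] gu)
  have in': "(\<kappa> x, components (U, \<kappa>) u) \<in> W'"
    using V(2) W(2) by (simp add: W'_def W1_def h_def Qp)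
  have "smooth_on W' (\<lambda>z. F (tchart_inv U \<kappa> (h z)))"
    by (rule smooth_on_compose[OF o' _ smooth_on_subset[OF h1] W(4)]) (auto simp: W'_def)
  then have "smooth_on W' (\<lambda>z. (f \<circ> unit_normalize g) (tchart_inv U \<kappa> z))"
  proof (rule smooth_on_cong[OF o', rotated])
    fix z assume z: "z \<in> W'"
    then have "fst z \<in> \<kappa> ` U" using sub by auto
    then have Uz: "inv_into U \<kappa> (fst z) \<in> U" by (rule inv_into_into)
    have Qz: "Q z > 0" using z by (simp add: W'_def W1_def)
    note T = chart_vec_in_tangent_space[OF c(1) Uz, of "snd z"]
    have N: "unit_normalize g (tchart_inv U \<kappa> z) = tchart_inv U \<kappa> (h z)"
      by (simp add: unit_normalize_def h_def chart_vec_scale[OF c(1) Uz] Q_def)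
    \<comment> \<open>\<open>f\<close> and \<open>F\<close> are known to agree only on unit
      vectors.\<close>
    have "unit_normalize g (tchart_inv U \<kappa> z) \<in> pts SM"
      using Qz T by (simp add: unit_normalize_def pts_SM tangent_space_scale metric_scale metric_scale_right
          Q_def[symmetric] real_sqrt_mult_self)
    then show "F (tchart_inv U \<kappa> (h z)) = (f \<circ> unit_normalize g) (tchart_inv U \<kappa> z)"
      by (simp add: fF N)
  qed
  with o' in' sub show "\<exists>W. open W \<and> (\<kappa> x, components (U, \<kappa>) u) \<in> W \<and> W \<subseteq> \<kappa> ` U \<times> UNIV \<and>
      smooth_on W (\<lambda>z. (f \<circ> unit_normalize g) (tchart_inv U \<kappa> z))"
    by (intro exI[of _ W'] conjI)
qed

lemma smooth_at_SM_add: "smooth_at SM p f \<Longrightarrow> smooth_at SM p h \<Longrightarrow> smooth_at SM p (\<lambda>q. f q + h q)"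
  unfolding unit_tangent_bundle_def tangent_bundle_def by (rule smooth_at_submanifold_add)

lemma smooth_at_SM_mult: "smooth_at SM p f \<Longrightarrow> smooth_at SM p h \<Longrightarrow> smooth_at SM p (\<lambda>q. f q * h q)"
  unfolding unit_tangent_bundle_def tangent_bundle_def by (rule smooth_at_submanifold_mult)

lemma smooth_at_SM_cmult: "smooth_at SM p f \<Longrightarrow> smooth_at SM p (\<lambda>q. r * f q)"
  unfolding unit_tangent_bundle_def tangent_bundle_def by (rule smooth_at_submanifold_cmult)

text \<open>The lift differentiates along the curve \<open>l\<close> of unit vectors through
  \<open>(x, u)\<close>, so the rules for real derivatives give the laws of a derivation. Stated for
  every \<open>X\<close>, since the tangential lift subtracts a multiple of the lift of
  \<open>u\<close> itself.\<close>

lemma unit_vertical_lift_in_tangent_space: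
  assumes p: "(x, u) \<in> pts SM" and X: "X \<in> tangent_space M x"
  shows "unit_vertical_lift A g (x, u) X \<in> tangent_space SM (x, u)"
proof -
  have u: "u \<in> tangent_space M x" and gu: "g x u u = 1" using p by (simp_all add: pts_SM)
  define l where "l s = unit_normalize g (x, u + s *\<^sub>T X)" for s
  define R where "R = unit_vertical_lift A g (x, u) X"
  have R: "R f = deriv (\<lambda>s. f (l s)) 0" if "smooth_at SM (x, u) f" for f
    using that smooth_at_unit_normalize[OF p that]
    by (simp add: R_def unit_vertical_lift_def restrict_tvec_def vertical_lift_def l_def)
  have d: "((\<lambda>s. f (l s)) has_real_derivative R f) (at 0)" if f: "smooth_at SM (x, u) f" for f
    using fiber_line_differentiable[OF u X smooth_at_unit_normalize[OF p f]]
    by (simp add: R[OF f] l_def)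
  have l0: "l 0 = (x, u)" by (simp add: l_def unit_normalize_def gu)
  have "R (\<lambda>q. f q + h q) = R f + R h" "R (\<lambda>q. f q * h q) = f (x, u) * R h + h (x, u) * R f"
    if f: "smooth_at SM (x, u) f" and h: "smooth_at SM (x, u) h" for f h
  proof -
    show "R (\<lambda>q. f q + h q) = R f + R h"
      by (rule DERIV_unique[OF d[OF smooth_at_SM_add[OF f h]] DERIV_add[OF d[OF f] d[OF h]]])
    show "R (\<lambda>q. f q * h q) = f (x, u) * R h + h (x, u) * R f"
      using DERIV_unique[OF d[OF smooth_at_SM_mult[OF f h]] DERIV_mult[OF d[OF f] d[OF h]]]
      by (simp add: l0 mult.commute)
  qed
  moreover have "R (\<lambda>q. r * f q) = r * R f" if f: "smooth_at SM (x, u) f" for r f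
    by (rule DERIV_unique[OF d[OF smooth_at_SM_cmult[OF f]] DERIV_cmult[OF d[OF f]]])
  moreover have "R f = 0" if "\<not> smooth_at SM (x, u) f" for f
    using that by (simp add: R_def unit_vertical_lift_def restrict_tvec_def)
  ultimately have "R \<in> tangent_space SM (x, u)" by (simp add: tangent_space_def)
  then show ?thesis by (simp only: R_def)
qed

end

section \<open>Homothetic deformations of paracontact metric structures\<close>

locale paracontact_metric =
  fixes X :: "('p, 'z) smooth_space_scheme" and n :: nat
    and \<phi> :: "'p endo" and \<xi> :: "'p field" and \<eta> :: "'p form" and G :: "'p bilin"
  assumes paracontact: "paracontact_metric_structure X n (\<phi>, \<xi>, \<eta>, G)"
begin

lemma almost_paracontact: "almost_paracontact_structure X n \<phi> \<xi> \<eta>"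
  using paracontact by (simp add: paracontact_metric_structure_def)

lemma pseudo_riemannian: "pseudo_riemannian_metric X G"
  using paracontact by (simp add: paracontact_metric_structure_def)

lemma fields: "endo_field X \<phi>" "vector_field X \<xi>" "one_form X \<eta>" "symmetric_tensor X G"
  using almost_paracontact pseudo_riemannian
  by (simp_all add: almost_paracontact_structure_def pseudo_riemannian_metric_def)

context
  fixes p assumes p: "p \<in> pts X"
begin

lemma xi_tangent: "\<xi> p \<in> tangent_space X p"
  using fields(2) p unfolding vector_field_def field_smooth_at_def by simp

lemma phi_tangent: "D \<in> tangent_space X p \<Longrightarrow> \<phi> p D \<in> tangent_space X p"
  and phi_add: "D \<in> tangent_space X p \<Longrightarrow> E \<in> tangent_space X p \<Longrightarrow> \<phi> p (D + E) = \<phi> p D + \<phi> p E"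
  and phi_scale: "D \<in> tangent_space X p \<Longrightarrow> \<phi> p (c *\<^sub>T D) = c *\<^sub>T \<phi> p D"
  using fields(1) p unfolding endo_field_def by simp_all

lemma eta_add: "D \<in> tangent_space X p \<Longrightarrow> E \<in> tangent_space X p \<Longrightarrow> \<eta> p (D + E) = \<eta> p D + \<eta> p E"
  and eta_scale: "D \<in> tangent_space X p \<Longrightarrow> \<eta> p (c *\<^sub>T D) = c * \<eta> p D"
  and eta_smooth: "field_smooth_at X p V \<Longrightarrow> smooth_at X p (\<lambda>q. \<eta> q (V q))"
  using fields(3) p unfolding one_form_def by simp_all

lemma G_sym: "D \<in> tangent_space X p \<Longrightarrow> E \<in> tangent_space X p \<Longrightarrow> G p D E = G p E D"
  and G_add: "D \<in> tangent_space X p \<Longrightarrow> E \<in> tangent_space X p \<Longrightarrow> F \<in> tangent_space X p \<Longrightarrow>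
    G p (D + E) F = G p D F + G p E F"
  and G_scale: "D \<in> tangent_space X p \<Longrightarrow> E \<in> tangent_space X p \<Longrightarrow> G p (c *\<^sub>T D) E = c * G p D E"
  and G_smooth: "field_smooth_at X p V \<Longrightarrow> field_smooth_at X p W \<Longrightarrow> smooth_at X p (\<lambda>q. G q (V q) (W q))"
  using fields(4) p unfolding symmetric_tensor_def by simp_all

lemma G_nondegenerate:
  "D \<in> tangent_space X p \<Longrightarrow> (\<And>E. E \<in> tangent_space X p \<Longrightarrow> G p D E = 0) \<Longrightarrow> D = 0"
  using pseudo_riemannian p unfolding pseudo_riemannian_metric_def by simp

lemma eta_xi: "\<eta> p (\<xi> p) = 1"
  and phi_phi: "D \<in> tangent_space X p \<Longrightarrow> \<phi> p (\<phi> p D) = D - \<eta> p D *\<^sub>T \<xi> p"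
  using almost_paracontact p unfolding almost_paracontact_structure_def by simp_all

lemma G_phi_phi: "D \<in> tangent_space X p \<Longrightarrow> E \<in> tangent_space X p \<Longrightarrow>
    G p (\<phi> p D) (\<phi> p E) = - G p D E + \<eta> p D * \<eta> p E"
  and d_eta: "field_smooth_at X p V \<Longrightarrow> field_smooth_at X p W \<Longrightarrow>
    ext_deriv X \<eta> V W p = G p (V p) (\<phi> p (W p))"
  using paracontact p unfolding paracontact_metric_structure_def by simp_all

section \<open>Standard identities of paracontact metric structures\<close>

lemma phi_zero: "\<phi> p 0 = 0"
  using phi_scale[OF xi_tangent, of 0] by simp

lemma eta_zero: "\<eta> p 0 = 0"
  using eta_scale[OF xi_tangent, of 0] by simp

text \<open>Put \<open>E = \<phi> \<xi>\<close>. From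
  \<open>\<phi> E = \<phi> (\<phi> \<xi>) = 0\<close> the square formula gives
  \<open>E = \<eta>(E) \<xi>\<close>. Applying \<phi> gives \<open>\<eta>(E) E = 0\<close>, and
  applying \<eta> makes the square of \<open>\<eta>(E)\<close> vanish.\<close>

lemma phi_xi: "\<phi> p (\<xi> p) = 0"
proof -
  define E where "E = \<phi> p (\<xi> p)"
  have E: "E \<in> tangent_space X p" unfolding E_def by (rule phi_tangent[OF xi_tangent])
  have 0: "\<phi> p E = 0" using phi_phi[OF xi_tangent] by (simp add: E_def eta_xi)
  then have eq: "E = \<eta> p E *\<^sub>T \<xi> p" using phi_phi[OF E] by (simp add: phi_zero)
  have "\<phi> p (\<eta> p E *\<^sub>T \<xi> p) = \<eta> p E *\<^sub>T E"
    using phi_scale[OF xi_tangent] by (simp add: E_def)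
  then have "\<eta> p E *\<^sub>T E = 0" using 0 unfolding eq[symmetric] by simp
  then have "\<eta> p (\<eta> p E *\<^sub>T E) = 0" by (simp add: eta_zero)
  then have "\<eta> p E = 0" by (simp add: eta_scale[OF E])
  then show ?thesis using eq by (simp add: E_def)
qed

text \<open>Compute the cube of \<phi> at \<open>D\<close> in two ways, using the square formula at
  \<open>D\<close> and at \<open>\<phi> D\<close>; the results differ by
  \<open>\<eta>(\<phi> D) \<xi>\<close>.\<close>

lemma eta_phi:
  assumes D: "D \<in> tangent_space X p"
  shows "\<eta> p (\<phi> p D) = 0"
proof -
  note E = phi_tangent[OF D]
  have "\<phi> p (\<phi> p D) = D + (- \<eta> p D) *\<^sub>T \<xi> p"
    using phi_phi[OF D] by (simp add: fun_eq_iff)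
  then have "\<phi> p (\<phi> p (\<phi> p D)) = \<phi> p D + (- \<eta> p D) *\<^sub>T \<phi> p (\<xi> p)"
    by (simp only: phi_add[OF D tangent_space_scale[OF xi_tangent]] phi_scale[OF xi_tangent])
  then have "\<eta> p (\<phi> p D) *\<^sub>T \<xi> p = 0"
    using phi_phi[OF E] by (simp add: phi_xi fun_eq_iff)
  then have "\<eta> p (\<eta> p (\<phi> p D) *\<^sub>T \<xi> p) = 0" by (simp add: eta_zero)
  then show ?thesis by (simp add: eta_scale[OF xi_tangent] eta_xi)
qed

text \<open>The compatibility of \<open>G\<close> with \<phi>, taken at \<xi>, has left side zero
  because \<phi> kills \<xi>.\<close>

lemma G_xi:
  assumes D: "D \<in> tangent_space X p"
  shows "G p D (\<xi> p) = \<eta> p D"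
proof -
  have "G p (0 *\<^sub>T \<xi> p) (\<phi> p D) = 0"
    by (simp only: G_scale[OF xi_tangent phi_tangent[OF D]] mult_zero_left)
  then have "G p (\<phi> p (\<xi> p)) (\<phi> p D) = 0" by (simp add: phi_xi)
  then show ?thesis
    using G_phi_phi[OF xi_tangent D] by (simp add: eta_xi G_sym[OF D xi_tangent])
qed

end

text \<open>The algebra structure on germs is assumed here, since a \<open>smooth_space\<close> record carries no axioms.\<close>

lemma D_homothetic_structure:
  assumes smooth_add: "\<And>p f h. smooth_at X p f \<Longrightarrow> smooth_at X p h \<Longrightarrow> smooth_at X p (\<lambda>q. f q + h q)"
    and smooth_mult: "\<And>p f h. smooth_at X p f \<Longrightarrow> smooth_at X p h \<Longrightarrow> smooth_at X p (\<lambda>q. f q * h q)"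
    and smooth_cmult: "\<And>p f c. smooth_at X p f \<Longrightarrow> smooth_at X p (\<lambda>q. c * f q)"
    and t: "t \<noteq> 0"
  shows "paracontact_metric_structure X n (D_homothetic t (\<phi>, \<xi>, \<eta>, G))"
proof -
  define \<xi>' where "\<xi>' q = (1 / t) *\<^sub>T \<xi> q" for q
  define \<eta>' where "\<eta>' q D = t * \<eta> q D" for q D
  define G' where "G' q D E = t * G q D E + t * (t - 1) * (\<eta> q D * \<eta> q E)" for q D E
  have smooth_xi: "field_smooth_at X p \<xi>'" if "p \<in> pts X" for p
    unfolding field_smooth_at_def
  proof (intro conjI ballI allI impI)
    fix q assume "q \<in> pts X"
    then show "\<xi>' q \<in> tangent_space X q"
      unfolding \<xi>'_def by (intro tangent_space_scale xi_tangent)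
  next
    fix f assume "smooth_at X p f"
    then have "smooth_at X p (\<lambda>q. \<xi> q f)"
      using fields(2) \<open>p \<in> pts X\<close> unfolding vector_field_def field_smooth_at_def by simp
    then show "smooth_at X p (\<lambda>q. \<xi>' q f)"
      unfolding \<xi>'_def tscale_apply by (rule smooth_cmult)
  qed
  have one_form: "one_form X \<eta>'"
    unfolding one_form_def \<eta>'_def
    by (auto simp: eta_add eta_scale algebra_simps intro: smooth_cmult eta_smooth)
  have almost: "almost_paracontact_structure X n \<phi> \<xi>' \<eta>'"
    unfolding almost_paracontact_structure_def
  proof (intro conjI ballI fields one_form)
    show "vector_field X \<xi>'" unfolding vector_field_def by (intro ballI smooth_xi)
    fix p assume p: "p \<in> pts X"
    show "\<eta>' p (\<xi>' p) = 1"
      using t by (simp add: \<eta>'_def \<xi>'_def eta_scale[OF p xi_tangent[OF p]] eta_xi[OF p])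
    show "\<phi> p (\<phi> p D) = D - \<eta>' p D *\<^sub>T \<xi>' p" if "D \<in> tangent_space X p" for D
      using t by (simp add: \<eta>'_def \<xi>'_def phi_phi[OF p that])
    show "vector_space.dim tscale {D \<in> tangent_space X p. \<phi> p D = D} = n"
      "vector_space.dim tscale {D \<in> tangent_space X p. \<phi> p D = - D} = n"
      using almost_paracontact p by (simp_all add: almost_paracontact_structure_def)
  qed
  have symmetric: "symmetric_tensor X G'"
    unfolding symmetric_tensor_def
  proof (intro conjI ballI allI impI)
    fix p assume p: "p \<in> pts X"
    fix D E F assume D: "D \<in> tangent_space X p" and E: "E \<in> tangent_space X p"
    show "G' p D E = G' p E D" by (simp add: G'_def G_sym[OF p D E])
    show "G' p (c *\<^sub>T D) E = c * G' p D E" for c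
      by (simp add: G'_def G_scale[OF p D E] eta_scale[OF p D] algebra_simps)
    assume F: "F \<in> tangent_space X p"
    show "G' p (D + E) F = G' p D F + G' p E F"
      by (simp add: G'_def G_add[OF p D E F] eta_add[OF p D E] algebra_simps)
  next
    fix p V W assume p: "p \<in> pts X" and V: "field_smooth_at X p V" and W: "field_smooth_at X p W"
    show "smooth_at X p (\<lambda>q. G' q (V q) (W q))"
      unfolding G'_def
      by (intro smooth_add smooth_cmult[OF G_smooth[OF p V W]]
          smooth_cmult[OF smooth_mult[OF eta_smooth[OF p V] eta_smooth[OF p W]]])
  qed
  have pseudo: "pseudo_riemannian_metric X G'"
    unfolding pseudo_riemannian_metric_def
  proof (intro conjI symmetric ballI impI)
    fix p D assume p: "p \<in> pts X" and D: "D \<in> tangent_space X p"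
      and 0: "\<forall>E\<in>tangent_space X p. G' p D E = 0"
    \<comment> \<open>Testing against \<xi> isolates \<open>\<eta>(D)\<close>, with total
      coefficient \<open>t * t\<close>. Once it vanishes, \<open>G'\<close> is \<open>t\<close>
      times \<open>G\<close> on \<open>D\<close> and nondegeneracy is inherited.\<close>
    have "t * \<eta> p D + t * (t - 1) * \<eta> p D = 0"
      using bspec[OF 0 xi_tangent[OF p]] by (simp add: G'_def G_xi[OF p D] eta_xi[OF p])
    then have "t * t * \<eta> p D = 0" by (simp add: algebra_simps)
    then have "\<eta> p D = 0" using t by simp
    then show "D = 0"
      using 0 t by (intro G_nondegenerate[OF p D]) (simp add: G'_def)
  qed
  \<comment> \<open>Since \<eta> vanishes on the image of \<phi>, the left side is just
    \<open>t\<close> times its old value; on the right the two multiples of \<eta> \<otimes> \<eta>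
    combine to the coefficient \<open>t\<close>.\<close>
  have "G' p (\<phi> p D) (\<phi> p E) = - G' p D E + \<eta>' p D * \<eta>' p E"
    if "p \<in> pts X" "D \<in> tangent_space X p" "E \<in> tangent_space X p" for p D E
    using that by (simp add: G'_def \<eta>'_def G_phi_phi eta_phi algebra_simps)
  moreover have "ext_deriv X \<eta>' V W p = G' p (V p) (\<phi> p (W p))"
    if p: "p \<in> pts X" and V: "field_smooth_at X p V" and W: "field_smooth_at X p W" for p V W
  proof -
    have T: "V p \<in> tangent_space X p" "W p \<in> tangent_space X p"
      using V W p unfolding field_smooth_at_def by simp_all
    \<comment> \<open>\<open>t\<close> is constant, so derivations pull it out. On the metric side
      the correction term drops because \<eta> kills \<open>\<phi> (W p)\<close>.\<close>
    have "ext_deriv X \<eta>' V W p = t * ext_deriv X \<eta> V W p"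
      by (simp add: ext_deriv_def \<eta>'_def tangent_spaceD(3)[OF T(1) eta_smooth[OF p W]]
          tangent_spaceD(3)[OF T(2) eta_smooth[OF p V]] algebra_simps)
    then show ?thesis by (simp add: d_eta[OF p V W] G'_def eta_phi[OF p T(2)])
  qed
  ultimately have "paracontact_metric_structure X n (\<phi>, \<xi>', \<eta>', G')"
    using almost pseudo unfolding paracontact_metric_structure_def prod.case by (intro conjI ballI allI impI)
  then show ?thesis
    unfolding D_homothetic_def prod.case \<xi>'_def \<eta>'_def G'_def .
qed

end

section \<open>Deformation of the \<open>g\<close>-natural structures\<close>

text \<open>\<open>restrict_tvec\<close> is linear in the vector, so the lift splits; the constants
  then appear only in the coefficient of the horizontal lift of \<open>u\<close>.\<close>

lemma tangential_lift_eq: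
  "tangential_lift A g nabla a b c d (x, u) Y =
    unit_vertical_lift A g (x, u) Y + (- g x Y u) *\<^sub>T unit_vertical_lift A g (x, u) u
      + (b / (a + c + d) * g x Y u) *\<^sub>T unit_horizontal_lift A g nabla (x, u) u"
  by (simp add: fun_eq_iff tangential_lift_def unit_vertical_lift_def unit_horizontal_lift_def
      restrict_tvec_def)

context riemannian_atlas
begin

lemma D_homothetic_g_natural:
  assumes S: "g_natural_paracontact_with A g nabla n a b c d \<rho> (\<phi>, \<xi>, \<eta>, G)"
    and \<rho>: "\<rho> \<noteq> 0" and t: "t \<noteq> 0"
  shows "g_natural_paracontact_with A g nabla n (t * a) (t * b) (t * c) (t * d + t * (t - 1) / \<rho>\<^sup>2) (\<rho> / t)
    (D_homothetic t (\<phi>, \<xi>, \<eta>, G))"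
proof -
  define d' where "d' = t * d + t * (t - 1) / \<rho>\<^sup>2"
  define \<alpha> where "\<alpha> = a * (a + c) - b\<^sup>2"
  define s where "s = a + c + d"
  have pc: "paracontact_metric_structure SM n (\<phi>, \<xi>, \<eta>, G)"
    and nat: "g_natural_metric A g nabla a b c d G"
    and s: "s = - 4 * \<alpha>" "s = 1 / \<rho>\<^sup>2"
    using S by (simp_all add: g_natural_paracontact_with_def Let_def \<alpha>_def s_def)
  interpret paracontact_metric SM n \<phi> \<xi> \<eta> G
    by unfold_locales (rule pc)
  have s0: "s \<noteq> 0" using s \<rho> by auto
  \<comment> \<open>Scaling contributes \<open>t * s\<close> and the \<eta> \<otimes> \<eta> term
    \<open>t * (t - 1) * s\<close>, because \<open>1 / \<rho>\<^sup>2\<close> is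
    \<open>s\<close>.\<close>
  have s': "t * a + t * c + d' = t\<^sup>2 * s"
  proof -
    have "d' = t * d + t * (t - 1) * s" by (simp add: d'_def s(2))
    then show ?thesis by (simp add: s_def algebra_simps power2_eq_square)
  qed
  have \<alpha>': "t * a * (t * a + t * c) - (t * b)\<^sup>2 = t\<^sup>2 * \<alpha>"
    by (simp add: \<alpha>_def algebra_simps power2_eq_square)
  let ?h = "unit_horizontal_lift A g nabla" and ?v = "unit_vertical_lift A g"
    and ?\<tau> = "tangential_lift A g nabla a b c d"
    and ?\<tau>' = "tangential_lift A g nabla (t * a) (t * b) (t * c) d'"
  have lifts: "\<xi> (x, u) = \<rho> *\<^sub>T ?h (x, u) u"
    "Y \<in> tangent_space M x \<Longrightarrow> \<eta> (x, u) (?h (x, u) Y) = 1 / \<rho> * g x Y u"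
    "Y \<in> tangent_space M x \<Longrightarrow> \<eta> (x, u) (?\<tau> (x, u) Y) = b * \<rho> * g x Y u"
    "Y \<in> tangent_space M x \<Longrightarrow> \<phi> (x, u) (?h (x, u) Y) = (1 / (2 * \<rho> * \<alpha>)) *\<^sub>T
       (- b *\<^sub>T ?h (x, u) Y + (a + c) *\<^sub>T ?\<tau> (x, u) Y + (b * d / s * g x Y u) *\<^sub>T ?h (x, u) u)"
    "Y \<in> tangent_space M x \<Longrightarrow> \<phi> (x, u) (?\<tau> (x, u) Y) = (1 / (2 * \<rho> * \<alpha>)) *\<^sub>T
       (- a *\<^sub>T ?h (x, u) Y + b *\<^sub>T ?\<tau> (x, u) Y + ((a * s - b\<^sup>2) / s * g x Y u) *\<^sub>T ?h (x, u) u)"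
    if "(x, u) \<in> pts SM" for x u Y
    using bspec[OF S[unfolded g_natural_paracontact_with_def prod.case Let_def, folded \<alpha>_def s_def,
        THEN conjunct2, THEN conjunct2, THEN conjunct2, THEN conjunct2] that, unfolded prod.case] by simp_all
  have hu: "?h (x, u) u = (1 / \<rho>) *\<^sub>T \<xi> (x, u)" if "(x, u) \<in> pts SM" for x u
    using lifts(1)[OF that] \<rho> by simp
  have hu_T: "?h (x, u) u \<in> tangent_space SM (x, u)" if "(x, u) \<in> pts SM" for x u
    unfolding hu[OF that] by (rule tangent_space_scale[OF xi_tangent[OF that]])
  have \<tau>_T: "?\<tau> (x, u) Y \<in> tangent_space SM (x, u)"
    if p: "(x, u) \<in> pts SM" and Y: "Y \<in> tangent_space M x" for x u Y
    unfolding tangential_lift_eq using p Y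
    by (intro tangent_space_add tangent_space_scale unit_vertical_lift_in_tangent_space hu_T)
      (simp_all add: pts_SM)
  \<comment> \<open>The new value of \<open>b / (a + c + d)\<close> minus the old one: the two
    tangential lifts differ by this multiple of the horizontal lift of \<open>u\<close>.\<close>
  define k where "k = t * b / (t\<^sup>2 * s) - b / s"
  have \<tau>': "?\<tau>' (x, u) Y = ?\<tau> (x, u) Y + (k * g x Y u) *\<^sub>T ?h (x, u) u" for x u Y
    unfolding tangential_lift_eq s' s_def[symmetric] k_def by (simp add: fun_eq_iff algebra_simps)
  have v_\<tau>: "?v (x, u) Y = ?\<tau> (x, u) Y" if "g x Y u = 0" for x u Y
    using that by (simp add: tangential_lift_eq)
  define \<eta>' where "\<eta>' q D = t * \<eta> q D" for q D
  define G' where "G' q D E = t * G q D E + t * (t - 1) * (\<eta> q D * \<eta> q E)" for q D E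
  have deformed: "D_homothetic t (\<phi>, \<xi>, \<eta>, G) = (\<phi>, \<lambda>q. (1 / t) *\<^sub>T \<xi> q, \<eta>', G')"
    by (simp add: D_homothetic_def \<eta>'_def G'_def fun_eq_iff)
  have pc': "paracontact_metric_structure SM n (\<phi>, \<lambda>q. (1 / t) *\<^sub>T \<xi> q, \<eta>', G')"
    unfolding deformed[symmetric]
    by (rule D_homothetic_structure[OF smooth_at_SM_add smooth_at_SM_mult smooth_at_SM_cmult t])
  have natG: "Y1 \<in> tangent_space M x \<Longrightarrow> Y2 \<in> tangent_space M x \<Longrightarrow>
      G (x, u) (?h (x, u) Y1) (?h (x, u) Y2) = (a + c) * g x Y1 Y2 + d * g x Y1 u * g x Y2 u"
    "Y1 \<in> tangent_space M x \<Longrightarrow> Y2 \<in> tangent_space M x \<Longrightarrow> g x Y2 u = 0 \<Longrightarrow>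
      G (x, u) (?h (x, u) Y1) (?v (x, u) Y2) = b * g x Y1 Y2"
    "Y1 \<in> tangent_space M x \<Longrightarrow> Y2 \<in> tangent_space M x \<Longrightarrow> g x Y1 u = 0 \<Longrightarrow> g x Y2 u = 0 \<Longrightarrow>
      G (x, u) (?v (x, u) Y1) (?v (x, u) Y2) = a * g x Y1 Y2"
    if "(x, u) \<in> pts SM" for x u Y1 Y2
    using nat that by (auto simp: g_natural_metric_def Let_def)
  \<comment> \<open>For \<open>Y\<close> orthogonal to \<open>u\<close> the vertical lift is the
    tangential one, on which \<eta> is prescribed.\<close>
  have eta_v: "\<eta> (x, u) (?v (x, u) Y) = 0"
    if "(x, u) \<in> pts SM" "Y \<in> tangent_space M x" "g x Y u = 0" for x u Y
    using lifts(3)[OF that(1,2)] that(3) by (simp add: v_\<tau>)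
  have nat': "g_natural_metric A g nabla (t * a) (t * b) (t * c) d' G'"
    unfolding g_natural_metric_def Let_def
  proof (intro conjI ballI; (clarify)?)
    show "symmetric_tensor SM G'"
      using pc' by (simp add: paracontact_metric_structure_def pseudo_riemannian_metric_def)
  next
    fix x u Y1 Y2 assume p: "(x, u) \<in> pts SM"
    note simps = G'_def natG[OF p] eta_v[OF p] lifts(2)[OF p]
    show "(\<forall>X1\<in>tangent_space M x. \<forall>X2\<in>tangent_space M x. G' (x, u) (?h (x, u) X1) (?h (x, u) X2)
        = (t * a + t * c) * g x X1 X2 + d' * g x X1 u * g x X2 u) \<and>
      (\<forall>X1\<in>tangent_space M x. \<forall>Y1\<in>{Y \<in> tangent_space M x. g x Y u = 0}.
        G' (x, u) (?h (x, u) X1) (?v (x, u) Y1) = t * b * g x X1 Y1) \<and>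
      (\<forall>Y1\<in>{Y \<in> tangent_space M x. g x Y u = 0}. \<forall>Y2\<in>{Y \<in> tangent_space M x. g x Y u = 0}.
        G' (x, u) (?v (x, u) Y1) (?v (x, u) Y2) = t * a * g x Y1 Y2)"
      using \<rho> by (auto simp: simps d'_def field_simps power2_eq_square)
  qed
  \<comment> \<open>Equality of the coefficients of the horizontal lift of \<open>u\<close> in
    \<phi> of a horizontal lift, after division by \<open>t\<close>: the term with \<open>k\<close>
    comes from exchanging the tangential lift, the other from the new \<open>b\<close> and
    \<open>d\<close>.\<close>
  have coeff_h: "(a + c) * k + b * d' / (t\<^sup>2 * s) = b * d / s"
  proof -
    have ac: "a + c = s - d" by (simp add: s_def)
    have d': "d' = t\<^sup>2 * s - t * (s - d)" using s' by (simp add: s_def algebra_simps)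
    show ?thesis unfolding ac d' k_def using t s0 by (simp add: field_simps power2_eq_square)
  qed
  \<comment> \<open>The corresponding balance for \<phi> of a tangential lift.\<close>
  have coeff_\<tau>: "b * k + (a * (t\<^sup>2 * s) - t * b\<^sup>2) / (t\<^sup>2 * s) = (a * s - b\<^sup>2) / s"
    unfolding k_def using t s0 by (simp add: field_simps power2_eq_square)
  have main: "(1 / t) *\<^sub>T \<xi> (x, u) = (\<rho> / t) *\<^sub>T ?h (x, u) u \<and>
      (\<forall>Y\<in>tangent_space M x.
         \<eta>' (x, u) (?h (x, u) Y) = 1 / (\<rho> / t) * g x Y u \<and>
         \<eta>' (x, u) (?\<tau>' (x, u) Y) = t * b * (\<rho> / t) * g x Y u \<and>
         \<phi> (x, u) (?h (x, u) Y) = (1 / (2 * (\<rho> / t) * (t\<^sup>2 * \<alpha>))) *\<^sub>T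
           (- (t * b) *\<^sub>T ?h (x, u) Y + (t * a + t * c) *\<^sub>T ?\<tau>' (x, u) Y
             + (t * b * d' / (t\<^sup>2 * s) * g x Y u) *\<^sub>T ?h (x, u) u) \<and>
         \<phi> (x, u) (?\<tau>' (x, u) Y) = (1 / (2 * (\<rho> / t) * (t\<^sup>2 * \<alpha>))) *\<^sub>T
           (- (t * a) *\<^sub>T ?h (x, u) Y + (t * b) *\<^sub>T ?\<tau>' (x, u) Y
             + ((t * a * (t\<^sup>2 * s) - (t * b)\<^sup>2) / (t\<^sup>2 * s) * g x Y u) *\<^sub>T ?h (x, u) u))"
    if p: "(x, u) \<in> pts SM" for x u
  proof (intro conjI ballI)
    show "(1 / t) *\<^sub>T \<xi> (x, u) = (\<rho> / t) *\<^sub>T ?h (x, u) u" by (simp add: lifts(1)[OF p])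
    fix Y assume Y: "Y \<in> tangent_space M x"
    note T = \<tau>_T[OF p Y] tangent_space_scale[OF hu_T[OF p], of "k * g x Y u"]
    have eta_hu: "\<eta> (x, u) (?h (x, u) u) = 1 / \<rho>"
      unfolding hu[OF p] by (simp add: eta_scale[OF p xi_tangent[OF p]] eta_xi[OF p])
    have phi_hu: "\<phi> (x, u) (?h (x, u) u) = 0"
      unfolding hu[OF p] by (simp add: phi_scale[OF p xi_tangent[OF p]] phi_xi[OF p] fun_eq_iff)
    show "\<eta>' (x, u) (?h (x, u) Y) = 1 / (\<rho> / t) * g x Y u"
      by (simp add: \<eta>'_def lifts(2)[OF p Y])
    have "\<eta>' (x, u) (?\<tau>' (x, u) Y) = t * (b * \<rho> * g x Y u + k * g x Y u * (1 / \<rho>))"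
      unfolding \<eta>'_def \<tau>' eta_add[OF p T] eta_scale[OF p hu_T[OF p]] eta_hu lifts(3)[OF p Y] ..
    \<comment> \<open>As \<open>1 / s = \<rho>\<^sup>2\<close>, the extra term
      \<open>k / \<rho>\<close> equals \<open>b * \<rho> / t - b * \<rho>\<close>, so
      \<open>b * \<rho> / t\<close> remains inside the bracket.\<close>
    then show "\<eta>' (x, u) (?\<tau>' (x, u) Y) = t * b * (\<rho> / t) * g x Y u"
      using t \<rho> by (simp add: k_def s(2) field_simps power2_eq_square)
    \<comment> \<open>The prefactor loses one power of \<open>t\<close>, which cancels the factor
      \<open>t\<close> by which the bracket grows; this is how \<phi> can stay the same.\<close>
    have f: "1 / (2 * (\<rho> / t) * (t\<^sup>2 * \<alpha>)) = 1 / (2 * \<rho> * \<alpha>) / t"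
      using t by (simp add: power2_eq_square)
    show "\<phi> (x, u) (?h (x, u) Y) = (1 / (2 * (\<rho> / t) * (t\<^sup>2 * \<alpha>))) *\<^sub>T
           (- (t * b) *\<^sub>T ?h (x, u) Y + (t * a + t * c) *\<^sub>T ?\<tau>' (x, u) Y
             + (t * b * d' / (t\<^sup>2 * s) * g x Y u) *\<^sub>T ?h (x, u) u)"
    proof -
      have "- (t * b) * H + (t * a + t * c) * (T + k * y * U) + t * b * d' / (t\<^sup>2 * s) * y * U
          = t * (- b * H + (a + c) * T + b * d / s * y * U)" for H T U y
        unfolding coeff_h[symmetric] by (simp add: algebra_simps)
      then show ?thesis
        unfolding lifts(4)[OF p Y] \<tau>' f using t by (simp add: fun_eq_iff)
    qed
    show "\<phi> (x, u) (?\<tau>' (x, u) Y) = (1 / (2 * (\<rho> / t) * (t\<^sup>2 * \<alpha>))) *\<^sub>T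
           (- (t * a) *\<^sub>T ?h (x, u) Y + (t * b) *\<^sub>T ?\<tau>' (x, u) Y
             + ((t * a * (t\<^sup>2 * s) - (t * b)\<^sup>2) / (t\<^sup>2 * s) * g x Y u) *\<^sub>T ?h (x, u) u)"
    proof -
      have e: "(t * a * (t\<^sup>2 * s) - (t * b)\<^sup>2) / (t\<^sup>2 * s) = t * ((a * (t\<^sup>2 * s) - t * b\<^sup>2) / (t\<^sup>2 * s))"
        by (simp add: power2_eq_square algebra_simps)
      have "- (t * a) * H + t * b * (T + k * y * U) + (t * a * (t\<^sup>2 * s) - (t * b)\<^sup>2) / (t\<^sup>2 * s) * y * U
          = t * (- a * H + b * T + (a * s - b\<^sup>2) / s * y * U)" for H T U y
        unfolding coeff_\<tau>[symmetric] e by (simp add: algebra_simps)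
      \<comment> \<open>The two lifts differ by a multiple of \<xi>, which \<phi>
        annihilates.\<close>
      moreover have "\<phi> (x, u) (?\<tau>' (x, u) Y) = \<phi> (x, u) (?\<tau> (x, u) Y)"
        unfolding \<tau>' phi_add[OF p T] phi_scale[OF p hu_T[OF p]] phi_hu by (simp add: fun_eq_iff)
      ultimately show ?thesis
        unfolding lifts(5)[OF p Y] \<tau>' f using t by (simp add: fun_eq_iff)
    qed
  qed
  have rho'1: "t\<^sup>2 * s = - 4 * (t\<^sup>2 * \<alpha>)" by (simp add: s(1))
  have "t\<^sup>2 * s = 1 / (\<rho> / t)\<^sup>2" by (simp add: s(2) power_divide)
  with rho'1 have rho'2: "- 4 * (t\<^sup>2 * \<alpha>) = 1 / (\<rho> / t)\<^sup>2" by simp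
  show ?thesis
    unfolding deformed g_natural_paracontact_with_def prod.case Let_def d'_def[symmetric] s' \<alpha>'
    using pc' nat' rho'1 rho'2 main by (intro conjI) auto
qed

end

theorem theorem2:
  fixes A :: "('m::{t2_space,second_countable_topology}, real ^ 'n::finite) chart set"
    and g :: "'m bilin"
    and nabla :: "'m field \<Rightarrow> 'm field \<Rightarrow> 'm field"
    and S :: "('m \<times> 'm tvec) pc_structure"
    and n :: nat and t :: real
  assumes "smooth_manifold A" and "CARD('n) = n + 1" and "n \<ge> 1"
    and "riemannian_metric (manifold_space A) g"
    and "levi_civita_connection (manifold_space A) g nabla"
    and "t \<noteq> 0"
  shows "(g_natural_paracontact_metric_structure A g nabla n S \<and> t > 0 \<longrightarrow>
            g_natural_paracontact_metric_structure A g nabla n (D_homothetic t S)) \<and>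
         (signed_g_natural_paracontact_metric_structure A g nabla n S \<longrightarrow>
            signed_g_natural_paracontact_metric_structure A g nabla n (D_homothetic t S))"
proof -
  interpret riemannian_atlas A g
    by unfold_locales (rule assms(1,4))+
  obtain \<phi> \<xi> \<eta> G where S: "S = (\<phi>, \<xi>, \<eta>, G)" by (cases S)
  \<comment> \<open>The new parameter is left explicit as \<open>\<rho> / t\<close>: the two halves
    of the conclusion differ only in what is known of its sign.\<close>
  have deformed: "\<exists>a' b' c' d'. g_natural_paracontact_with A g nabla n a' b' c' d' (\<rho> / t) (D_homothetic t S)"
    if "g_natural_paracontact_with A g nabla n a b c d \<rho> S" "\<rho> \<noteq> 0" for a b c d \<rho>
    using D_homothetic_g_natural[OF that(1)[unfolded S] that(2) assms(6)] unfolding S by (intro exI)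
  show ?thesis
    unfolding g_natural_paracontact_metric_structure_def signed_g_natural_paracontact_metric_structure_def
  proof (intro conjI impI; elim conjE exE)
    fix a b c d \<rho> assume *: "t > 0" "\<rho> > 0" "g_natural_paracontact_with A g nabla n a b c d \<rho> S"
    obtain a' b' c' d' where "g_natural_paracontact_with A g nabla n a' b' c' d' (\<rho> / t) (D_homothetic t S)"
      using deformed[OF *(3)] *(2) by auto
    then show "\<exists>a b c d \<rho>. \<rho> > 0 \<and> g_natural_paracontact_with A g nabla n a b c d \<rho> (D_homothetic t S)"
      using *(1,2) by (intro exI conjI) (rule divide_pos_pos)
  next
    fix a b c d \<rho> assume *: "\<rho> \<noteq> 0" "g_natural_paracontact_with A g nabla n a b c d \<rho> S"
    obtain a' b' c' d' where "g_natural_paracontact_with A g nabla n a' b' c' d' (\<rho> / t) (D_homothetic t S)"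
      using deformed[OF *(2,1)] by auto
    moreover have "\<rho> / t \<noteq> 0" using *(1) assms(6) by simp
    ultimately show "\<exists>a b c d \<rho>. \<rho> \<noteq> 0 \<and> g_natural_paracontact_with A g nabla n a b c d \<rho> (D_homothetic t S)"
      by (intro exI conjI)
  qed
qed

end
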